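(* Consider the Galerkin MsFEM problem: find $u_H^\varepsilon\in V_H^\varepsilon$ such that $a^\varepsilon(u_H^\varepsilon,v_H^\varepsilon)=F(v_H^\varepsilon)$ for all $v_H^\varepsilon\in V_H^\varepsilon$, with stiffness matrix $\mathbb{A}^\varepsilon_{j,i}=a^\varepsilon(\phi_i^\varepsilon,\phi_j^\varepsilon)$; the Petrov-Galerkin MsFEM problem: find $u_H^{\varepsilon,PG}\in V_H^\varepsilon$ such that $a^\varepsilon(u_H^{\varepsilon,PG},v_H)=F(v_H)$ for all $v_H\in V_H$, with stiffness matrix $\mathbb{A}^{\varepsilon,PG}_{j,i}=a^\varepsilon(\phi_i^\varepsilon,\phi_j^{\mathbb{P}_1})$; and the $\mathbb{P}_1$ problem: find $u_H\in V_H$ such that $a^{\overline{A}}(u_H,v_H)=F(v_H)$ for all $v_H\in V_H$, with stiffness matrix $\mathbb{A}^{\mathbb{P}_1}_{j,i}=a^{\overline{A}}(\phi_i^{\mathbb{P}_1},\phi_j^{\mathbb{P}_1})$ and right-hand side vector $\mathbb{F}^{\mathbb{P}_1}_j=F(\phi_j^{\mathbb{P}_1})$ ($1\le i,j\le N_v$). Then: 1. $\mathbb{A}^\varepsilon=\mathbb{A}^{\varepsilon,PG}$ (and thus both are equal to $\mathbb{A}^{\mathbb{P}_1}$). 2. The right-hand side vector of the Petrov-Galerkin MsFEM problem is equal to $\mathbb{F}^{\mathbb{P}_1}$. 3. The solution $u_H^{\varepsilon,PG}$ to the Petrov-Galerkin MsFEM problem coincides with the function $\overline{u}_H^\varepsilon$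 defined from the solution $u_H$ to the $\mathbb{P}_1$ problem by $\overline{u}_H^\varepsilon=u_H+\sum_{\alpha=1}^d(\partial_\alpha u_H)|_K\,\chi_K^{\varepsilon,\alpha}$ in each $K\in\mathcal{T}_H$.
   Context: Let $\Omega\subset\mathbb{R}^d$ be a bounded domain and let $A^\varepsilon\in L^\infty(\Omega,\mathbb{R}^{d\times d})$ (not necessarily symmetric, no further structure assumed) satisfy, for some constants $M\ge m>0$ independent of $\varepsilon$: for all $\xi,\eta\in\mathbb{R}^d$, $m|\xi|^2\le \xi\cdot A^\varepsilon(x)\xi$ and $|\eta\cdot A^\varepsilon(x)\xi|\le M|\xi||\eta|$ for a.e. $x\in\Omega$. Bilinear and linear forms: $a^\varepsilon(u,v)=\int_\Omega\nabla v\cdot A^\varepsilon\nabla u$ and $F(v)=\int_\Omega f v$ on $H^1_0(\Omega)$, where $f$ is such that $F$ is a well-defined bounded linear form on $H^1_0(\Omega)$ (e.g. $f\in L^2(\Omega)$); for $K\subset\Omega$, $a^\varepsilon_K(u,v)=\int_K\nabla v\cdot A^\varepsilon\nabla u$. Mesh and $\mathbb{P}_1$ space: $\mathcal{T}_H$ is a conformal simplicial mesh of $\Omega$ (triangles if $d=2$, tetrahedra if $d=3$), $x_1,\dots,x_{N_v}$ are its interior vertices (those not lying on $\partial\Omega$), $V_H\subset H^1_0(\Omega)$ is the usual space of continuous functions that are affine on each $K\in\mathcal{T}_H$ and vanish on $\partial\Omega$, and $\phi_i^{\mathbb{P}_1}\in V_H$ is the unique element with $\phi_i^{\mathbb{P}_1}(x_j)=\delta_{i,j}$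 for all $1\le j\le N_v$. Multiscale basis functions: $\phi_i^\varepsilon\in H^1_0(\Omega)$ is defined by: for every $K\in\mathcal{T}_H$, $-\operatorname{div}(A^\varepsilon\nabla\phi_i^\varepsilon)=0$ in $K$ (in the weak sense) and $\phi_i^\varepsilon=\phi_i^{\mathbb{P}_1}$ on $\partial K$. Set $V_H^\varepsilon=\operatorname{span}\{\phi_i^\varepsilon,\ 1\le i\le N_v\}$. The linear systems of the Galerkin and Petrov-Galerkin MsFEM problems are written in the basis $(\phi_i^\varepsilon)_i$ of $V_H^\varepsilon$ for the unknown, with test functions $\phi_j^\varepsilon$ and $\phi_j^{\mathbb{P}_1}$ respectively. Local functions: for $K\in\mathcal{T}_H$ and $1\le\alpha\le d$, $\chi_K^{\varepsilon,\alpha}\in H^1_0(K)$ is the (weak) solution to $-\operatorname{div}(A^\varepsilon\nabla\chi_K^{\varepsilon,\alpha})=\operatorname{div}(A^\varepsilon e_\alpha)$ in $K$, $\chi_K^{\varepsilon,\alpha}=0$ on $\partial K$, where $e_\alpha$ is the $\alpha$-th canonical unit vector of $\mathbb{R}^d$. Effective matrix: $\overline{A}$ is the piecewise constant matrix field on $\mathcal{T}_H$ given by $\overline{A}_{\beta,\alpha}|_K=\frac{1}{|K|}\,a^\varepsilon_K\big(x^\alpha+\chi_K^{\varepsilon,\alpha},\,x^\beta+\chi_K^{\varepsilon,\beta}\big)$ for $K\in\mathcal{T}_H$, $1\le\alpha,\beta\le d$, where $x^\alpha=x\cdot e_\alpha$ is the $\alpha$-th coordinate function and $|K|$ is the measure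 of $K$. Finally $a^{\overline{A}}(u,v)=\int_\Omega\nabla v\cdot\overline{A}\nabla u$. *)

theory Defs
  imports "HOL-Analysis.Analysis"
begin

text \<open>
  Functions on a subset of \<open>\<real>\<^sup>d\<close> are represented by total functions on \<open>real ^ 'n\<close>, with
  \<open>d = CARD('n)\<close>; each notion below that refers to a set \<open>S\<close> only looks at values in \<open>S\<close>.
  Elements of Sobolev spaces are representatives, not classes modulo null sets.
\<close>

subsection \<open>Test functions and Sobolev spaces\<close>

definition pd :: "'n \<Rightarrow> (real ^ 'n::finite \<Rightarrow> real) \<Rightarrow> real ^ 'n \<Rightarrow> real" where
  "pd i f x = frechet_derivative f (at x) (axis i 1)"

primrec Ck :: "nat \<Rightarrow> (real ^ 'n::finite \<Rightarrow> real) \<Rightarrow> bool" where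
  "Ck 0 f \<longleftrightarrow> continuous_on UNIV f"
| "Ck (Suc k) f \<longleftrightarrow> (\<forall>x. f differentiable (at x)) \<and> (\<forall>i. Ck k (pd i f))"

definition test_functions :: "(real ^ 'n::finite) set \<Rightarrow> (real ^ 'n \<Rightarrow> real) set" where
  "test_functions S = {\<phi>. (\<forall>k. Ck k \<phi>) \<and> compact (closure {x. \<phi> x \<noteq> 0}) \<and> closure {x. \<phi> x \<noteq> 0} \<subseteq> S}"

definition L2 :: "(real ^ 'n::finite) set \<Rightarrow> (real ^ 'n \<Rightarrow> 'b::euclidean_space) set" where
  "L2 S = {u. set_borel_measurable lebesgue S u \<and> set_integrable lebesgue S (\<lambda>x. (norm (u x))\<^sup>2)}"

definition is_weak_grad ::
  "(real ^ 'n::finite) set \<Rightarrow> (real ^ 'n \<Rightarrow> real) \<Rightarrow> (real ^ 'n \<Rightarrow> real ^ 'n) \<Rightarrow> bool" where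
  "is_weak_grad S u g \<longleftrightarrow> g \<in> L2 S \<and>
     (\<forall>\<phi>\<in>test_functions S. \<forall>i.
        (LINT x:S|lebesgue. u x * pd i \<phi> x) = - (LINT x:S|lebesgue. g x $ i * \<phi> x))"

definition H1 :: "(real ^ 'n::finite) set \<Rightarrow> (real ^ 'n \<Rightarrow> real) set" where
  "H1 S = {u \<in> L2 S. \<exists>g. is_weak_grad S u g}"

text \<open>For open \<open>S\<close> and \<open>u \<in> H1 S\<close>, the choice is immaterial up to null sets.\<close>

definition wgrad :: "(real ^ 'n::finite) set \<Rightarrow> (real ^ 'n \<Rightarrow> real) \<Rightarrow> real ^ 'n \<Rightarrow> real ^ 'n" where
  "wgrad S u = (SOME g. is_weak_grad S u g)"

definition H1_norm :: "(real ^ 'n::finite) set \<Rightarrow> (real ^ 'n \<Rightarrow> real) \<Rightarrow> real" where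
  "H1_norm S u = sqrt ((LINT x:S|lebesgue. (u x)\<^sup>2) + (LINT x:S|lebesgue. (norm (wgrad S u x))\<^sup>2))"

definition H10 :: "(real ^ 'n::finite) set \<Rightarrow> (real ^ 'n \<Rightarrow> real) set" where
  "H10 S = {u \<in> H1 S. \<exists>\<phi>. (\<forall>k. \<phi> k \<in> test_functions S) \<and>
              (\<lambda>k::nat. H1_norm S (\<lambda>x. u x - \<phi> k x)) \<longlonglongrightarrow> 0}"

subsection \<open>Coefficient, bilinear and linear forms\<close>

definition Linfty :: "(real ^ 'n::finite) set \<Rightarrow> (real ^ 'n \<Rightarrow> 'b::euclidean_space) set" where
  "Linfty S = {B. set_borel_measurable lebesgue S B \<and>
                  (\<exists>C. AE x in lebesgue. x \<in> S \<longrightarrow> norm (B x) \<le> C)}"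

definition bform ::
  "(real ^ 'n::finite) set \<Rightarrow> (real ^ 'n \<Rightarrow> real ^ 'n ^ 'n) \<Rightarrow> (real ^ 'n \<Rightarrow> real) \<Rightarrow> (real ^ 'n \<Rightarrow> real) \<Rightarrow> real" where
  "bform S B u v = (LINT x:S|lebesgue. wgrad S v x \<bullet> (B x *v wgrad S u x))"

definition lform :: "(real ^ 'n::finite) set \<Rightarrow> (real ^ 'n \<Rightarrow> real) \<Rightarrow> (real ^ 'n \<Rightarrow> real) \<Rightarrow> real" where
  "lform S f v = (LINT x:S|lebesgue. f x * v x)"

definition bounded_lform_on_H10 :: "(real ^ 'n::finite) set \<Rightarrow> (real ^ 'n \<Rightarrow> real) \<Rightarrow> bool" where
  "bounded_lform_on_H10 S f \<longleftrightarrow>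
     (\<forall>v\<in>H10 S. set_integrable lebesgue S (\<lambda>x. f x * v x)) \<and>
     (\<exists>C. \<forall>v\<in>H10 S. \<bar>lform S f v\<bar> \<le> C * H1_norm S v)"

subsection \<open>Mesh and \<open>\<bbbP>\<^sub>1\<close> space\<close>

text \<open>Mesh elements are closed simplices, \<open>triangulation\<close> is the conformity condition; the
  functions of Sobolev type on an element \<open>K\<close> live on the open set \<open>interior K\<close>.\<close>

definition simplicial_mesh :: "(real ^ 'n::finite) set \<Rightarrow> (real ^ 'n) set set \<Rightarrow> bool" where
  "simplicial_mesh \<Omega> T \<longleftrightarrow> triangulation T \<and> (\<forall>K\<in>T. int CARD('n) simplex K) \<and>
     \<Union>T = closure \<Omega> \<and> (\<forall>K\<in>T. interior K \<subseteq> \<Omega>)"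

definition interior_vertices :: "(real ^ 'n::finite) set \<Rightarrow> (real ^ 'n) set set \<Rightarrow> (real ^ 'n) set" where
  "interior_vertices \<Omega> T = {x. \<exists>K\<in>T. x extreme_point_of K} - frontier \<Omega>"

text \<open>Elements of \<open>V\<^sub>H\<close> are extended by zero outside \<open>\<Omega>\<close>, so that an element is determined as a
  total function; since \<open>\<Omega>\<close> is open this contains the vanishing on \<open>frontier \<Omega>\<close>.\<close>

definition VH :: "(real ^ 'n::finite) set \<Rightarrow> (real ^ 'n) set set \<Rightarrow> (real ^ 'n \<Rightarrow> real) set" where
  "VH \<Omega> T = {u \<in> H10 \<Omega>. continuous_on (closure \<Omega>) u \<and>
     (\<forall>K\<in>T. \<exists>g c. \<forall>x\<in>K. u x = g \<bullet> x + c) \<and> (\<forall>x. x \<notin> \<Omega> \<longrightarrow> u x = 0)}"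

definition P1_basis ::
  "(real ^ 'n::finite) set \<Rightarrow> (real ^ 'n) set set \<Rightarrow> nat \<Rightarrow> (nat \<Rightarrow> real ^ 'n) \<Rightarrow> (nat \<Rightarrow> real ^ 'n \<Rightarrow> real) \<Rightarrow> bool" where
  "P1_basis \<Omega> T N xs \<phi> \<longleftrightarrow>
     (\<forall>i\<in>{1..N}. \<phi> i \<in> VH \<Omega> T \<and> (\<forall>j\<in>{1..N}. \<phi> i (xs j) = (if i = j then 1 else 0)))"

subsection \<open>Multiscale functions and effective matrix\<close>

text \<open>\<open>\<phi>\<epsilon> = \<phi>\<close> on the boundary of \<open>K\<close> is read as \<open>\<phi>\<epsilon> - \<phi> \<in> H\<^sup>1\<^sub>0(K)\<close>.\<close>

definition ms_basis_function ::
  "(real ^ 'n::finite) set \<Rightarrow> (real ^ 'n) set set \<Rightarrow> (real ^ 'n \<Rightarrow> real ^ 'n ^ 'n) \<Rightarrow> (real ^ 'n \<Rightarrow> real) \<Rightarrow> (real ^ 'n \<Rightarrow> real) \<Rightarrow> bool" where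
  "ms_basis_function \<Omega> T A \<phi> \<phi>\<epsilon> \<longleftrightarrow> \<phi>\<epsilon> \<in> H10 \<Omega> \<and>
     (\<forall>K\<in>T. (\<forall>v\<in>H10 (interior K). bform (interior K) A \<phi>\<epsilon> v = 0) \<and>
            (\<lambda>x. \<phi>\<epsilon> x - \<phi> x) \<in> H10 (interior K))"

definition span_fun :: "nat \<Rightarrow> (nat \<Rightarrow> 'a \<Rightarrow> real) \<Rightarrow> ('a \<Rightarrow> real) set" where
  "span_fun N \<psi> = {u. \<exists>c. u = (\<lambda>x. \<Sum>i\<in>{1..N}. c i * \<psi> i x)}"

definition corrector ::
  "(real ^ 'n::finite) set \<Rightarrow> (real ^ 'n \<Rightarrow> real ^ 'n ^ 'n) \<Rightarrow> 'n \<Rightarrow> (real ^ 'n \<Rightarrow> real) \<Rightarrow> bool" where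
  "corrector K A \<alpha> w \<longleftrightarrow> w \<in> H10 (interior K) \<and>
     (\<forall>v\<in>H10 (interior K). bform (interior K) A w v =
        - (LINT x:interior K|lebesgue. wgrad (interior K) v x \<bullet> (A x *v axis \<alpha> 1)))"

definition eff_matrix ::
  "(real ^ 'n \<Rightarrow> real ^ 'n ^ 'n) \<Rightarrow> ((real ^ 'n::finite) set \<Rightarrow> 'n \<Rightarrow> real ^ 'n \<Rightarrow> real) \<Rightarrow> (real ^ 'n) set \<Rightarrow> real ^ 'n ^ 'n" where
  "eff_matrix A w K = (\<chi> \<beta> \<alpha>. 1 / measure lebesgue K *
     bform (interior K) A (\<lambda>x. x $ \<alpha> + w K \<alpha> x) (\<lambda>x. x $ \<beta> + w K \<beta> x))"

text \<open>The interiors of the mesh elements are disjoint, so at most one summand is nonzero.\<close>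

definition eff_field ::
  "(real ^ 'n::finite) set set \<Rightarrow> (real ^ 'n \<Rightarrow> real ^ 'n ^ 'n) \<Rightarrow> ((real ^ 'n) set \<Rightarrow> 'n \<Rightarrow> real ^ 'n \<Rightarrow> real) \<Rightarrow> real ^ 'n \<Rightarrow> real ^ 'n ^ 'n" where
  "eff_field T A w x = (\<Sum>K\<in>T. indicator (interior K) x *\<^sub>R eff_matrix A w K)"

subsection \<open>Discrete problems\<close>

definition solves ::
  "('f \<Rightarrow> 'f \<Rightarrow> real) \<Rightarrow> ('f \<Rightarrow> real) \<Rightarrow> 'f set \<Rightarrow> 'f set \<Rightarrow> 'f \<Rightarrow> bool" where
  "solves a F U V u \<longleftrightarrow> u \<in> U \<and> (\<forall>v\<in>V. a u v = F v)"

record linear_system =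
  stiffness :: "nat \<Rightarrow> nat \<Rightarrow> real"
  rhs :: "nat \<Rightarrow> real"

text \<open>The unknown is expanded in the family \<open>\<phi>\<close>, the test functions are the \<open>\<psi> j\<close>.\<close>

definition system_of ::
  "('f \<Rightarrow> 'f \<Rightarrow> real) \<Rightarrow> ('f \<Rightarrow> real) \<Rightarrow> (nat \<Rightarrow> 'f) \<Rightarrow> (nat \<Rightarrow> 'f) \<Rightarrow> linear_system" where
  "system_of a F \<phi> \<psi> = \<lparr>stiffness = (\<lambda>j i. a (\<phi> i) (\<psi> j)), rhs = (\<lambda>j. F (\<psi> j))\<rparr>"

end

theory Submission
  imports Defs
begin

text \<open>
  Let \<open>u\<close> be piecewise affine on the mesh, with gradient \<open>g\<close> on the element \<open>K\<close>, and let
  \<open>u\<epsilon>\<close> be a function with \<open>u\<epsilon> - u\<close> in \<open>H\<^sup>1\<^sub>0(K)\<close> that is \<open>A\<close>-harmonic in each \<open>K\<close>, meaning that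
  \<open>a\<^sub>K(u\<epsilon>, v) = 0\<close> for every \<open>v\<close> in \<open>H\<^sup>1\<^sub>0(K)\<close>. Such pairs \<open>(u, u\<epsilon>)\<close> (\<open>ms_pair\<close>) are stable
  under linear combination, and \<open>(\<phi>\<^sub>i, \<phi>\<epsilon>\<^sub>i)\<close> is one of them. All claims follow from four facts about pairs.

  \<^item> Inside \<open>K\<close>, both \<open>u\<epsilon>\<close> and \<open>u + \<Sum>\<^sub>\<alpha> g\<^sub>\<alpha> \<chi>\<^sub>\<alpha>\<close> are \<open>A\<close>-harmonic, and their difference is in
    \<open>H\<^sup>1\<^sub>0(K)\<close>. By coercivity the gradient of the difference vanishes, and by the Poincare inequality so
    does the difference (\<open>ms_pair_local\<close>).
  \<^item> \<open>v\<epsilon> - v\<close> is an admissible test function on each element, so \<open>a(u\<epsilon>, v\<epsilon>) = a(u\<epsilon>, v)\<close>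
    (\<open>bform_ms_pair_petrov\<close>): Galerkin and Petrov-Galerkin matrices agree.
  \<^item> On \<open>K\<close> the gradient of \<open>u\<epsilon>\<close> is the combination, with coefficients \<open>g\<^sub>\<alpha>\<close>, of the gradients of
    \<open>x\<^sub>\<alpha> + \<chi>\<^sub>\<alpha>\<close>; bilinearity and the definition of the effective matrix turn
    \<open>a\<^sub>K(u\<epsilon>, v\<epsilon>)\<close> into the \<open>\<bbbP>\<^sub>1\<close> form with coefficient \<open>eff_matrix A w K\<close>
    (\<open>bform_ms_pair_effective\<close>).
  \<^item> If \<open>a(u\<epsilon>, u\<epsilon>) \<le> 0\<close> then \<open>\<nabla>u\<epsilon> = 0\<close>; since functions in \<open>H\<^sup>1\<^sub>0(K)\<close> have gradients of mean
    zero, \<open>g = 0\<close> on every element, and \<open>u = 0\<close> by the Poincare inequality on \<open>\<Omega>\<close>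
    (\<open>ms_pair_zero_if_energy_zero\<close>).

  The last fact makes the common stiffness matrix positive definite, hence the linear system, which the
  Petrov-Galerkin and the \<open>\<bbbP>\<^sub>1\<close> problem share, has exactly one solution. The two discrete
  solutions therefore have the same coefficients and form a pair, and the first fact is the claimed
  representation.

  The Sobolev space theory that this uses is developed from test functions. A weak gradient is unique up to
  null sets by the fundamental lemma of the calculus of variations, which needs enough smooth functions
  with compact support; a continuously differentiable function has its classical gradient as weak gradient
  because the integral of a partial derivative with compact support vanishes. Both the Poincare
  inequality and the mean value statement about gradients are cases of this integration by parts.
\<close>

section \<open>Partial derivatives and smooth functions\<close>

lemma pd_eqI: "(f has_derivative f') (at x) \<Longrightarrow> pd i f x = f' (axis i 1)"
  unfolding pd_def by (metis frechet_derivative_at)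

lemma pd_add:
  assumes "f differentiable (at x)" "g differentiable (at x)"
  shows "pd i (\<lambda>x. f x + g x) x = pd i f x + pd i g x"
  using pd_eqI[OF has_derivative_add[OF assms[unfolded frechet_derivative_works]]]
  unfolding pd_def .

lemma pd_mult:
  assumes "f differentiable (at x)" "g differentiable (at x)"
  shows "pd i (\<lambda>x. f x * g x) x = f x * pd i g x + pd i f x * g x"
  using pd_eqI[OF has_derivative_mult[OF assms[unfolded frechet_derivative_works]]]
  unfolding pd_def .

lemma pd_const: "pd i (\<lambda>x. c) = (\<lambda>x. 0)"
  using pd_eqI[OF has_derivative_const] by blast

lemma Ck_SucD: "Ck (Suc k) f \<Longrightarrow> Ck k f"
proof (induction k arbitrary: f)
  case 0
  then show ?case
    by (auto intro: differentiable_imp_continuous_within simp: continuous_on_eq_continuous_within)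
qed auto

lemma Ck_const: "Ck k (\<lambda>x. c)"
proof (induction k arbitrary: c)
  case (Suc k)
  then show ?case by (simp add: pd_const)
qed auto

lemma Ck_add: "Ck k f \<Longrightarrow> Ck k g \<Longrightarrow> Ck k (\<lambda>x. f x + g x)"
proof (induction k arbitrary: f g)
  case 0
  then show ?case by (auto intro: continuous_intros)
next
  case (Suc k)
  then have "pd i (\<lambda>x. f x + g x) = (\<lambda>x. pd i f x + pd i g x)" for i
    by (auto simp: pd_add)
  with Suc show ?case by auto
qed

lemma Ck_mult: "Ck k f \<Longrightarrow> Ck k g \<Longrightarrow> Ck k (\<lambda>x. f x * g x)"
proof (induction k arbitrary: f g)
  case 0
  then show ?case by (auto intro: continuous_intros)
next
  case (Suc k)
  then have "pd i (\<lambda>x. f x * g x) = (\<lambda>x. f x * pd i g x + pd i f x * g x)" for i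
    by (auto simp: pd_mult)
  moreover have "Ck k f" "Ck k g"
    using Suc.prems by (auto intro: Ck_SucD)
  ultimately show ?case using Suc by (auto intro!: Ck_add)
qed

lemma Ck_diff: "Ck k f \<Longrightarrow> Ck k g \<Longrightarrow> Ck k (\<lambda>x. f x - g x)"
  using Ck_add[of k f "\<lambda>x. (-1) * g x"] Ck_mult[OF Ck_const, of k g "-1"] by simp

lemma Ck_prod: "finite I \<Longrightarrow> (\<And>i. i \<in> I \<Longrightarrow> Ck k (f i)) \<Longrightarrow> Ck k (\<lambda>x. \<Prod>i\<in>I. f i x)"
  by (induction I rule: finite_induct) (auto intro: Ck_const Ck_mult)

lemma Ck_power: "Ck k f \<Longrightarrow> Ck k (\<lambda>x. f x ^ n)"
  by (induction n) (auto intro: Ck_const Ck_mult)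

lemma has_derivative_affine:
  fixes g :: "real ^ 'n::finite"
  shows "((\<lambda>x. g \<bullet> x + c) has_derivative (\<lambda>h. g \<bullet> h)) (at x)"
  by (auto intro!: derivative_eq_intros)

lemma pd_affine: "pd i (\<lambda>x. g \<bullet> x + c) = (\<lambda>x. g $ i)"
  by (rule ext, subst pd_eqI[OF has_derivative_affine]) (simp add: inner_axis)

lemma Ck_affine: "Ck k (\<lambda>x. g \<bullet> x + c)"
proof (cases k)
  case 0
  then show ?thesis by (auto intro!: continuous_intros)
next
  case (Suc l)
  then show ?thesis by (auto simp: pd_affine Ck_const intro!: derivative_intros)
qed

lemma Ck_coord: "Ck k (\<lambda>x. x $ i)"
  using Ck_affine[of k "axis i 1" 0] by (simp add: inner_axis')

section \<open>Smooth bump functions\<close>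

text \<open>
  The functions \<open>exp (-1/t) / t^m\<close>, extended by zero to \<open>t \<le> 0\<close>, form a family that is closed under
  differentiation up to linear combination, so that smoothness of all of them is one induction.
\<close>

definition flat_exp :: "nat \<Rightarrow> real \<Rightarrow> real" where
  "flat_exp m t = (if 0 < t then exp (- (1 / t)) / t ^ m else 0)"

lemma flat_exp_tendsto_0: "(flat_exp m \<longlongrightarrow> 0) (at 0)"
proof (rule filterlim_split_at)
  show "(flat_exp m \<longlongrightarrow> 0) (at_left 0)"
    by (rule tendsto_eventually, rule eventually_at_leftI[of "-1"]) (auto simp: flat_exp_def)
  have "((\<lambda>t. inverse t ^ m / exp (inverse t)) \<longlongrightarrow> 0) (at_right (0::real))"
    by (rule filterlim_compose[OF tendsto_power_div_exp_0 filterlim_inverse_at_top_right])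
  then show "(flat_exp m \<longlongrightarrow> 0) (at_right 0)"
    by (rule Lim_transform_eventually)
       (auto simp: eventually_at_right_less flat_exp_def exp_minus field_simps
          intro!: eventually_at_rightI[of 0 1])
qed

lemma flat_exp_deriv:
  "(flat_exp m has_real_derivative flat_exp (m + 2) t - real m * flat_exp (m + 1) t) (at t)"
proof -
  consider "t < 0" | "t = 0" | "0 < t" by linarith
  then show ?thesis
  proof cases
    case 1
    have "((\<lambda>t. 0) has_real_derivative 0) (at t)" by simp
    then have "(flat_exp m has_real_derivative 0) (at t)"
      by (rule has_field_derivative_transform_within_open[where S="{..<0}"])
         (use 1 in \<open>auto simp: flat_exp_def\<close>)
    with 1 show ?thesis by (simp add: flat_exp_def)
  next
    case 2
    have "(\<lambda>h. (flat_exp m (0 + h) - flat_exp m 0) / h) = flat_exp (m + 1)"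
      by (auto simp: flat_exp_def)
    then have "(flat_exp m has_real_derivative 0) (at 0)"
      using flat_exp_tendsto_0[of "m + 1"] unfolding DERIV_def by simp
    with 2 show ?thesis by (simp add: flat_exp_def)
  next
    case 3
    have "m * inverse t ^ (m - Suc 0) * (inverse t * inverse t) = m * (inverse t * inverse t ^ m)"
      by (cases m) auto
    then have "((\<lambda>t. exp (- inverse t) * inverse t ^ m) has_real_derivative
        exp (- inverse t) * inverse t ^ (m + 2) - m * (exp (- inverse t) * inverse t ^ (m + 1))) (at t)"
      using 3 by (auto intro!: derivative_eq_intros simp: algebra_simps)
    moreover have "flat_exp k t = exp (- inverse t) * inverse t ^ k" if "0 < t" for k t
      using that by (simp add: flat_exp_def divide_inverse power_inverse)
    ultimately have "((\<lambda>t. exp (- (1 / t)) / t ^ m) has_real_derivative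
        flat_exp (m + 2) t - real m * flat_exp (m + 1) t) (at t)"
      using 3 by (simp add: divide_inverse power_inverse)
    then show ?thesis
      by (rule has_field_derivative_transform_within_open[where S="{0<..}"])
         (use 3 in \<open>auto simp: flat_exp_def\<close>)
  qed
qed

lemma Ck_flat_exp_affine:
  fixes g :: "real ^ 'n::finite"
  shows "Ck k (\<lambda>x. flat_exp m (g \<bullet> x + c))"
proof (induction k arbitrary: m)
  case 0
  have "continuous_on UNIV (flat_exp m)"
    using flat_exp_deriv by (intro continuous_at_imp_continuous_on) (blast intro: DERIV_isCont)
  then have "continuous_on UNIV (flat_exp m \<circ> (\<lambda>x. g \<bullet> x + c))"
    by (intro continuous_on_compose continuous_intros) (auto intro: continuous_on_subset)
  then show ?case by (simp add: o_def)
next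
  case (Suc k)
  let ?d = "\<lambda>t. flat_exp (m + 2) t - real m * flat_exp (m + 1) t"
  have D: "((\<lambda>x. flat_exp m (g \<bullet> x + c)) has_derivative (\<lambda>h. ?d (g \<bullet> x + c) * (g \<bullet> h))) (at x)" for x
    using has_derivative_compose[OF has_derivative_affine flat_exp_deriv[unfolded has_field_derivative_def]]
    by blast
  have "pd i (\<lambda>x. flat_exp m (g \<bullet> x + c)) = (\<lambda>x. ?d (g \<bullet> x + c) * g $ i)" for i
    by (rule ext, subst pd_eqI[OF D]) (simp add: inner_axis)
  moreover have "Ck k (\<lambda>x. ?d (g \<bullet> x + c) * g $ i)" for i
    by (intro Ck_mult Ck_diff Ck_const Suc.IH)
  moreover have "(\<lambda>x. flat_exp m (g \<bullet> x + c)) differentiable (at x)" for x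
    using D differentiableI by blast
  ultimately show ?case by auto
qed

text \<open>
  A product of one-dimensional factors \<open>exp (-1/t)\<close>, one for each of the faces of the box, where \<open>t\<close> is
  the distance to the hyperplane of the face, counted negative outside.
\<close>

lemma ex_smooth_box_bump:
  fixes a b :: "real ^ 'n::finite"
  obtains \<phi> :: "real ^ 'n \<Rightarrow> real"
  where "\<And>k. Ck k \<phi>" "\<And>x. 0 \<le> \<phi> x" "\<And>x. \<phi> x \<le> 1" "{x. \<phi> x \<noteq> 0} = box a b"
proof
  let ?\<phi> = "\<lambda>x. \<Prod>i\<in>UNIV. flat_exp 0 (axis i 1 \<bullet> x + - a $ i) * flat_exp 0 (- axis i 1 \<bullet> x + b $ i)"
  have ge0: "0 \<le> flat_exp 0 t" and le1: "flat_exp 0 t \<le> 1" and pos: "flat_exp 0 t \<noteq> 0 \<longleftrightarrow> 0 < t" for t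
    by (auto simp: flat_exp_def)
  show "Ck k ?\<phi>" for k
    by (intro Ck_prod Ck_mult Ck_flat_exp_affine) auto
  show "0 \<le> ?\<phi> x" "?\<phi> x \<le> 1" for x
    by (auto intro!: prod_nonneg prod_le_1 mult_nonneg_nonneg mult_le_one ge0 le1)
  show "{x. ?\<phi> x \<noteq> 0} = box a b"
    by (auto simp: mem_box_cart pos inner_axis')
qed

section \<open>Test functions\<close>

lemma test_functionsI:
  assumes "\<And>k. Ck k \<phi>" "compact C" "C \<subseteq> S" "\<And>x. x \<notin> C \<Longrightarrow> \<phi> x = 0"
  shows "\<phi> \<in> test_functions S"
proof -
  have "closure {x. \<phi> x \<noteq> 0} \<subseteq> C"
    using assms by (intro closure_minimal compact_imp_closed) auto
  with assms show ?thesis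
    unfolding test_functions_def
    by (auto simp: compact_eq_bounded_closed intro: bounded_subset)
qed

lemma test_functionsE:
  assumes "\<phi> \<in> test_functions S"
  obtains C where "compact C" "C \<subseteq> S" "\<And>x. x \<notin> C \<Longrightarrow> \<phi> x = 0"
proof (rule that[of "closure {x. \<phi> x \<noteq> 0}"])
  show "\<phi> x = 0" if "x \<notin> closure {x. \<phi> x \<noteq> 0}" for x
    using that closure_subset[of "{x. \<phi> x \<noteq> 0}"] by blast
qed (use assms in \<open>auto simp: test_functions_def\<close>)

lemma test_functions_Ck: "\<phi> \<in> test_functions S \<Longrightarrow> Ck k \<phi>"
  by (simp add: test_functions_def)

lemma test_functions_mono: "S \<subseteq> S' \<Longrightarrow> test_functions S \<subseteq> test_functions S'"
  by (auto simp: test_functions_def)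

lemma test_functions_0: "(\<lambda>x. 0) \<in> test_functions S"
  by (rule test_functionsI[of _ "{}"]) (auto intro: Ck_const)

lemma test_functions_add:
  assumes "\<phi> \<in> test_functions S" "\<psi> \<in> test_functions S"
  shows "(\<lambda>x. \<phi> x + \<psi> x) \<in> test_functions S"
proof -
  obtain C D where "compact C" "C \<subseteq> S" "\<And>x. x \<notin> C \<Longrightarrow> \<phi> x = 0"
      "compact D" "D \<subseteq> S" "\<And>x. x \<notin> D \<Longrightarrow> \<psi> x = 0"
    using assms test_functionsE by metis
  then show ?thesis
    using assms by (intro test_functionsI[of _ "C \<union> D"]) (auto intro: Ck_add test_functions_Ck)
qed

lemma test_functions_Ck_mult:
  assumes "\<phi> \<in> test_functions S" "\<And>k. Ck k p"
  shows "(\<lambda>x. p x * \<phi> x) \<in> test_functions S"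
proof -
  obtain C where "compact C" "C \<subseteq> S" "\<And>x. x \<notin> C \<Longrightarrow> \<phi> x = 0"
    using assms test_functionsE by metis
  then show ?thesis
    using assms by (intro test_functionsI[of _ C]) (auto intro: Ck_mult test_functions_Ck)
qed

text \<open>
  Only products and differences of smooth functions are needed: cover \<open>U\<close> by countably many boxes with bumps
  \<open>h\<^sub>k\<close> and take \<open>1 - \<Prod>\<^sub>k\<^sub><\<^sub>n (1 - h\<^sub>k)^n\<close>. A single factor already drives the product to zero at a point
  where its bump is positive.
\<close>

lemma test_functions_approx_indicator:
  fixes U :: "(real ^ 'n::finite) set"
  assumes "open U"
  obtains \<phi> :: "nat \<Rightarrow> real ^ 'n \<Rightarrow> real"
  where "\<And>n. \<phi> n \<in> test_functions U" "\<And>n x. 0 \<le> \<phi> n x" "\<And>n x. \<phi> n x \<le> 1"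
    "\<And>x. (\<lambda>n. \<phi> n x) \<longlonglongrightarrow> indicator U x"
proof (cases "U = {}")
  case True
  with that[of "\<lambda>_ _. 0"] show ?thesis by (auto intro: test_functions_0)
next
  case False
  let ?F = "{box a b | a b. cbox a b \<subseteq> U}"
  obtain F where F: "F \<subseteq> ?F" "countable F" "\<Union>F = \<Union>?F"
    using Lindelof[of ?F] by (auto simp: open_box)
  have "\<Union>?F = U"
  proof
    show "\<Union>?F \<subseteq> U" using box_subset_cbox by fastforce
    show "U \<subseteq> \<Union>?F"
    proof
      fix x assume "x \<in> U"
      then obtain a b where "x \<in> box a b" "cbox a b \<subseteq> U"
        using open_contains_cbox[of U x] assms by metis
      then show "x \<in> \<Union>?F" by auto
    qed
  qed
  with F False have "F \<noteq> {}" "\<Union>F = U" by auto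
  define B where "B = from_nat_into F"
  have rangeB: "range B = F"
    unfolding B_def using \<open>F \<noteq> {}\<close> F(2) by (rule range_from_nat_into)
  have "\<forall>n. \<exists>a b. B n = box a b \<and> cbox a b \<subseteq> U"
    using rangeB F(1) by blast
  then obtain a b where ab: "\<And>n. B n = box (a n) (b n)" "\<And>n. cbox (a n) (b n) \<subseteq> U"
    by metis
  have "\<forall>n. \<exists>h::real ^ 'n \<Rightarrow> real. (\<forall>k. Ck k h) \<and> (\<forall>x. 0 \<le> h x \<and> h x \<le> 1) \<and> {x. h x \<noteq> 0} = box (a n) (b n)"
    by (metis ex_smooth_box_bump)
  then obtain h :: "nat \<Rightarrow> real ^ 'n \<Rightarrow> real" where h: "\<And>n k. Ck k (h n)" "\<And>n x. 0 \<le> h n x" "\<And>n x. h n x \<le> 1"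
    "\<And>n. {x. h n x \<noteq> 0} = box (a n) (b n)"
    by metis
  \<comment> \<open>The exponent grows with the number of factors, so that one positive bump suffices for convergence to 1.\<close>
  let ?\<phi> = "\<lambda>n x. 1 - (\<Prod>k<n. (1 - h k x) ^ n)"
  have P: "0 \<le> (\<Prod>k<n. (1 - h k x) ^ n)" "(\<Prod>k<n. (1 - h k x) ^ n) \<le> 1" for n x
    using h(2,3) by (auto intro!: prod_nonneg prod_le_1 power_le_one)
  show ?thesis
  proof (rule that[of ?\<phi>])
    fix n x
    show "0 \<le> ?\<phi> n x" "?\<phi> n x \<le> 1" using P by auto
    show "?\<phi> n \<in> test_functions U"
    proof (rule test_functionsI)
      show "Ck k (?\<phi> n)" for k
        by (intro Ck_diff Ck_prod Ck_power Ck_const h) auto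
      show "compact (\<Union>k<n. cbox (a k) (b k))" by (intro compact_UN) auto
      show "(\<Union>k<n. cbox (a k) (b k)) \<subseteq> U" using ab by auto
      fix x assume "x \<notin> (\<Union>k<n. cbox (a k) (b k))"
      then have "h k x = 0" if "k < n" for k
        using that h(4)[of k] box_subset_cbox[of "a k" "b k"] by auto
      then show "?\<phi> n x = 0" by simp
    qed
  next
    fix x
    show "(\<lambda>n. ?\<phi> n x) \<longlonglongrightarrow> indicator U x"
    proof (cases "x \<in> U")
      case False
      then have "h k x = 0" for k
        using h(4)[of k] ab(2)[of k] box_subset_cbox[of "a k" "b k"] by auto
      with False show ?thesis by simp
    next
      case True
      then obtain k where "x \<in> B k" using \<open>\<Union>F = U\<close> rangeB by auto
      then have "h k x \<noteq> 0" using h(4)[of k] ab(1)[of k] by auto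
      then have k: "0 < h k x" using h(2)[of k x] by simp
      have "(\<lambda>n. \<Prod>k<n. (1 - h k x) ^ n) \<longlonglongrightarrow> 0"
      proof (rule tendsto_sandwich[OF _ _ tendsto_const])
        show "(\<lambda>n. (1 - h k x) ^ n) \<longlonglongrightarrow> 0"
          using k h(3)[of k x] by (intro LIMSEQ_realpow_zero) auto
        show "\<forall>\<^sub>F n in sequentially. (\<Prod>k<n. (1 - h k x) ^ n) \<le> (1 - h k x) ^ n"
        proof (rule eventually_sequentiallyI)
          fix n assume "Suc k \<le> n"
          then have "(\<Prod>j<n. (1 - h j x) ^ n) = (1 - h k x) ^ n * (\<Prod>j\<in>{..<n}-{k}. (1 - h j x) ^ n)"
            by (subst prod.remove[of _ k]) auto
          also have "\<dots> \<le> (1 - h k x) ^ n"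
            using h(2,3) by (intro mult_left_le prod_le_1) (auto intro!: power_le_one)
          finally show "(\<Prod>k<n. (1 - h k x) ^ n) \<le> (1 - h k x) ^ n" .
        qed
      qed (use P in auto)
      from tendsto_diff[OF tendsto_const this, of 1] True show ?thesis by simp
    qed
  qed
qed

section \<open>The fundamental lemma of the calculus of variations\<close>

text \<open>
  The open sets are an intersection-stable generator of the Borel sets, and the sets over which the integral of
  \<open>G\<close> vanishes form a Dynkin system; Lebesgue sets differ from Borel sets by null sets.
\<close>

lemma AE_zero_if_zero_on_open:
  fixes G :: "'a::euclidean_space \<Rightarrow> real"
  assumes G: "integrable lebesgue G"
    and open0: "\<And>U. open U \<Longrightarrow> (LINT x:U|lebesgue. G x) = 0"
  shows "AE x in lebesgue. G x = 0"
proof (rule density_unique_real[OF G])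
  have int: "set_integrable lebesgue B G" if "B \<in> sets lebesgue" for B
    unfolding set_integrable_def using that G by (rule integrable_mult_indicator)
  have borel0: "(LINT x:B|lebesgue. G x) = 0" if "B \<in> sigma_sets UNIV {U. open U}" for B :: "'a set"
  proof -
    have lm: "B \<in> sets lebesgue" if "B \<in> sigma_sets UNIV {U. open U}" for B :: "'a set"
      using that by (intro sets_completionI_sets) (simp add: borel_def)
    have "Int_stable {U::'a set. open U}" by (auto simp: Int_stable_def)
    from this Pow_UNIV[THEN equalityD2, THEN subset_trans[OF subset_UNIV]] that show ?thesis
    proof (induction B rule: sigma_sets_induct_disjoint)
      case (compl B)
      have "(LINT x:B \<union> (UNIV - B)|lebesgue. G x) = (LINT x:B|lebesgue. G x) + (LINT x:UNIV - B|lebesgue. G x)"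
        using lm[OF compl(1)] by (intro set_integral_Un int) auto
      with compl open0[of UNIV] show ?case by simp
    next
      case (union B)
      have "B i \<in> sets lebesgue" for i using union lm by blast
      then have "(LINT x:(\<Union>i. B i)|lebesgue. G x) = (\<Sum>i. (LINT x:B i|lebesgue. G x))"
        using union(1) by (intro lebesgue_integral_countable_add int) (auto simp: disjoint_family_on_def)
      with union show ?case by simp
    qed (auto intro: open0)
  qed
  show "integrable lebesgue (\<lambda>x. 0 :: real)" by simp
  fix A :: "'a set" assume "A \<in> sets lebesgue"
  define B where "B = main_part lborel A"
  have B: "B \<in> sets lborel"
    unfolding B_def using \<open>A \<in> sets lebesgue\<close> by (rule main_part_sets)
  have "AE x in lebesgue. x \<in> B \<longleftrightarrow> x \<in> A"
    unfolding B_def using \<open>A \<in> sets lebesgue\<close> by (intro AE_completion AE_in_main_part)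
  then have "AE x in lebesgue. indicator A x *\<^sub>R G x = indicator B x *\<^sub>R G x"
    by eventually_elim (simp add: indicator_def)
  then have "(LINT x:A|lebesgue. G x) = (LINT x:B|lebesgue. G x)"
    unfolding set_lebesgue_integral_def
    using int[OF \<open>A \<in> sets lebesgue\<close>] int[of B] B
    by (intro integral_cong_AE) (auto simp: set_integrable_def)
  also have "\<dots> = 0"
    using B by (intro borel0) (simp add: borel_def)
  finally show "(LINT x:A|lebesgue. G x) = (LINT x:A|lebesgue. 0)" by simp
qed

text \<open>
  Test functions approximate the indicator of an open set, so the integral of \<open>g\<close> over each open set
  vanishes.
\<close>

lemma fundamental_lemma:
  fixes g :: "real ^ 'n::finite \<Rightarrow> real"
  assumes S: "open S" and g: "integrable (lebesgue_on S) g"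
    and 0: "\<And>\<phi>. \<phi> \<in> test_functions S \<Longrightarrow> (LINT x|lebesgue_on S. g x * \<phi> x) = 0"
  shows "AE x in lebesgue_on S. g x = 0"
proof -
  have [measurable]: "S \<in> sets lebesgue" using S by auto
  define G where "G = (\<lambda>x. indicator S x * g x)"
  have G: "integrable lebesgue G"
    using g by (simp add: integrable_restrict_space G_def)
  have "AE x in lebesgue. G x = 0"
  proof (rule AE_zero_if_zero_on_open[OF G])
    fix U :: "(real ^ 'n) set" assume "open U"
    then obtain \<phi> :: "nat \<Rightarrow> real ^ 'n \<Rightarrow> real" where
      \<phi>: "\<And>n. \<phi> n \<in> test_functions (U \<inter> S)" "\<And>n x. 0 \<le> \<phi> n x" "\<And>n x. \<phi> n x \<le> 1"
        "\<And>x. (\<lambda>n. \<phi> n x) \<longlonglongrightarrow> indicator (U \<inter> S) x"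
      using test_functions_approx_indicator[of "U \<inter> S"] S by blast
    have meas: "\<phi> n \<in> borel_measurable lebesgue" for n
      using test_functions_Ck[OF \<phi>(1), of 0 n]
      by (auto intro!: measurable_completion borel_measurable_continuous_onI)
    have "(\<lambda>n. LINT x|lebesgue. G x * \<phi> n x) \<longlonglongrightarrow> (LINT x|lebesgue. G x * indicator (U \<inter> S) x)"
    proof (rule integral_dominated_convergence[where w="\<lambda>x. \<bar>G x\<bar>"])
      show "AE x in lebesgue. (\<lambda>n. G x * \<phi> n x) \<longlonglongrightarrow> G x * indicator (U \<inter> S) x"
        using \<phi>(4) by (auto intro!: tendsto_intros)
      show "AE x in lebesgue. norm (G x * \<phi> n x) \<le> \<bar>G x\<bar>" for n
        using \<phi>(2,3)[of n] by (auto simp: abs_mult intro!: mult_left_le)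
    qed (use G meas \<open>open U\<close> S in \<open>auto intro!: borel_measurable_times borel_measurable_indicator\<close>)
    moreover have "(LINT x|lebesgue. G x * \<phi> n x) = 0" for n
      using 0[of "\<phi> n"] \<phi>(1)[of n] test_functions_mono[of "U \<inter> S" S]
      by (auto simp: integral_restrict_space G_def mult.assoc)
    ultimately have "(LINT x|lebesgue. G x * indicator (U \<inter> S) x) = 0"
      by (simp add: LIMSEQ_const_iff)
    moreover have "(\<lambda>x. G x * indicator (U \<inter> S) x) = (\<lambda>x. indicator U x *\<^sub>R G x)"
      by (auto simp: G_def indicator_def)
    ultimately show "(LINT x:U|lebesgue. G x) = 0"
      by (simp add: set_lebesgue_integral_def)
  qed
  then show ?thesis
    by (subst AE_restrict_space_iff) (auto simp: G_def)
qed

section \<open>Integration by parts\<close>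

lemma pd_eq_0_outside:
  assumes "closed C" "\<And>x. x \<notin> C \<Longrightarrow> \<psi> x = 0" "x \<notin> C"
  shows "pd i \<psi> x = 0"
proof -
  have "((\<lambda>x. 0) has_derivative (\<lambda>h. 0)) (at x)" by simp
  then have "(\<psi> has_derivative (\<lambda>h. 0)) (at x)"
    by (rule has_derivative_transform_within_open[of _ _ _ _ "- C"]) (use assms in auto)
  from pd_eqI[OF this] show ?thesis .
qed

text \<open>
  The difference quotients of \<open>\<psi>\<close> in direction \<open>i\<close> have integral zero by translation invariance, and they converge
  to the partial derivative, dominated because of the mean value theorem and the compact support.
\<close>

lemma integral_pd_eq_0:
  fixes \<psi> :: "real ^ 'n::finite \<Rightarrow> real"
  assumes \<psi>: "Ck (Suc 0) \<psi>" and C: "compact C" "\<And>x. x \<notin> C \<Longrightarrow> \<psi> x = 0"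
  shows "(LINT x|lebesgue. pd i \<psi> x) = 0"
proof -
  let ?e = "axis i 1 :: real ^ 'n"
  have cont: "continuous_on UNIV \<psi>" using Ck_SucD[OF \<psi>] by simp
  have contd: "continuous_on UNIV (pd i \<psi>)" and diff: "\<And>x. \<psi> differentiable (at x)"
    using \<psi> by auto
  obtain R where R: "C \<subseteq> cball 0 R"
    using C(1) compact_imp_bounded bounded_subset_ballD ball_subset_cball by (meson subset_trans)
  have zero: "\<psi> x = 0" if "x \<notin> cball 0 R" for x using that R C(2) by blast
  have zerod: "pd i \<psi> x = 0" if "x \<notin> cball 0 R" for x
    using pd_eq_0_outside[of "cball 0 R" \<psi> x] zero that by blast
  have "bounded (pd i \<psi> ` cball 0 R)"
    using contd by (intro compact_imp_bounded compact_continuous_image) (auto intro: continuous_on_subset)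
  then obtain B where B: "0 < B" "\<And>x. x \<in> cball 0 R \<Longrightarrow> \<bar>pd i \<psi> x\<bar> \<le> B"
    by (auto simp: bounded_pos)
  then have B': "\<bar>pd i \<psi> x\<bar> \<le> B" for x using zerod by (cases "x \<in> cball 0 R") auto
  have line: "((\<lambda>s. \<psi> (x + s *\<^sub>R ?e)) has_real_derivative pd i \<psi> (x + s *\<^sub>R ?e)) (at s)" for x s
  proof -
    let ?D = "frechet_derivative \<psi> (at (x + s *\<^sub>R ?e))"
    have D: "(\<psi> has_derivative ?D) (at (x + s *\<^sub>R ?e))"
      using diff frechet_derivative_works by blast
    have "((\<lambda>s. x + s *\<^sub>R ?e) has_derivative (\<lambda>h. h *\<^sub>R ?e)) (at s)"
      by (auto intro!: derivative_eq_intros)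
    from has_derivative_compose[OF this D]
    have "((\<lambda>s. \<psi> (x + s *\<^sub>R ?e)) has_derivative (\<lambda>h. ?D (h *\<^sub>R ?e))) (at s)" .
    moreover have "(\<lambda>h. ?D (h *\<^sub>R ?e)) = (*) (pd i \<psi> (x + s *\<^sub>R ?e))"
      using linear_cmul[OF has_derivative_linear[OF D]] by (auto simp: pd_def)
    ultimately show ?thesis by (simp add: has_field_derivative_def)
  qed
  have "integrable lborel (\<lambda>x. indicator (cball 0 R) x *\<^sub>R \<psi> x)"
    using cont by (intro borel_integrable_compact) (auto intro: continuous_on_subset)
  moreover have "(\<lambda>x. indicator (cball 0 R) x *\<^sub>R \<psi> x) = \<psi>"
    using zero by (auto simp: fun_eq_iff indicator_def)
  ultimately have int: "integrable lborel \<psi>" by simp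
  have shift: "integrable lborel (\<lambda>x. \<psi> (x + c)) \<and> (LINT x|lborel. \<psi> (x + c)) = (LINT x|lborel. \<psi> x)" for c
  proof -
    have "integrable (distr lborel borel ((+) c)) \<psi>" using int by (simp add: lborel_distr_plus)
    then have "integrable lborel (\<lambda>x. \<psi> (c + x))"
      by (subst (asm) integrable_distr_eq) (use int in auto)
    moreover have "(LINT x|distr lborel borel ((+) c). \<psi> x) = (LINT x|lborel. \<psi> (c + x))"
      by (rule integral_distr) (use int in auto)
    ultimately show ?thesis by (simp add: lborel_distr_plus add.commute)
  qed
  define t where "t n = inverse (real (Suc n))" for n
  have t: "0 < t n" "t n \<le> 1" for n by (auto simp: t_def field_simps)
  let ?q = "\<lambda>n x. (\<psi> (x + t n *\<^sub>R ?e) - \<psi> x) / t n"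
  have "(\<lambda>n. LINT x|lborel. ?q n x) \<longlonglongrightarrow> (LINT x|lborel. pd i \<psi> x)"
  proof (rule integral_dominated_convergence[where w="\<lambda>x. indicator (cball 0 (R + 1)) x *\<^sub>R B"])
    show "pd i \<psi> \<in> borel_measurable lborel"
      using contd by (auto intro: borel_measurable_continuous_onI)
    show "?q n \<in> borel_measurable lborel" for n
      using shift[of "t n *\<^sub>R ?e"] int by (intro borel_measurable_divide borel_measurable_diff) auto
    show "integrable lborel (\<lambda>x. indicator (cball 0 (R + 1)) x *\<^sub>R B :: real)"
      by (intro borel_integrable_compact) auto
    show "AE x in lborel. (\<lambda>n. ?q n x) \<longlonglongrightarrow> pd i \<psi> x"
    proof (rule AE_I2)
      fix x
      have "((\<lambda>h. (\<psi> (x + h *\<^sub>R ?e) - \<psi> x) / h) \<longlongrightarrow> pd i \<psi> x) (at 0)"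
        using line[of x 0] by (simp add: DERIV_def)
      moreover have "filterlim t (at 0) sequentially"
      proof (rule filterlim_atI)
        show "t \<longlonglongrightarrow> 0"
          using LIMSEQ_inverse_real_of_nat by (simp add: t_def[abs_def])
        show "\<forall>\<^sub>F n in sequentially. t n \<noteq> 0"
          using t(1) by (intro always_eventually) (metis less_irrefl)
      qed
      ultimately show "(\<lambda>n. ?q n x) \<longlonglongrightarrow> pd i \<psi> x"
        by (rule filterlim_compose)
    qed
    show "AE x in lborel. norm (?q n x) \<le> indicator (cball 0 (R + 1)) x *\<^sub>R B" for n
    proof (rule AE_I2)
      fix x
      show "norm (?q n x) \<le> indicator (cball 0 (R + 1)) x *\<^sub>R B"
      proof (cases "x \<in> cball 0 (R + 1)")
        case True
        have "\<exists>z>0. z < t n \<and> \<psi> (x + t n *\<^sub>R ?e) - \<psi> (x + 0 *\<^sub>R ?e) = (t n - 0) * pd i \<psi> (x + z *\<^sub>R ?e)"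
          by (rule MVT2[OF t(1)]) (rule line)
        then obtain z where "\<psi> (x + t n *\<^sub>R ?e) - \<psi> x = t n * pd i \<psi> (x + z *\<^sub>R ?e)"
          by auto
        then have "?q n x = pd i \<psi> (x + z *\<^sub>R ?e)" using t(1)[of n] by simp
        with True B' show ?thesis by simp
      next
        case False
        \<comment> \<open>Outside the enlarged ball the shifted point is still outside the support, since the step is at most 1.\<close>
        have "norm x \<le> norm (x + t n *\<^sub>R ?e) + norm (t n *\<^sub>R ?e)"
          using norm_triangle_ineq4[of "x + t n *\<^sub>R ?e" "t n *\<^sub>R ?e"] by simp
        also have "norm (t n *\<^sub>R ?e) \<le> 1" using t[of n] by simp
        finally have "x + t n *\<^sub>R ?e \<notin> cball 0 R" "x \<notin> cball 0 R" using False by auto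
        then show ?thesis using zero False by simp
      qed
    qed
  qed
  moreover have "(LINT x|lborel. ?q n x) = 0" for n
    using shift[of "t n *\<^sub>R ?e"] int by simp
  ultimately have "(\<lambda>n::nat. 0) \<longlonglongrightarrow> (LINT x|lborel. pd i \<psi> x)" by (simp only:)
  then have "(LINT x|lborel. pd i \<psi> x) = 0" by (simp add: LIMSEQ_const_iff)
  then show ?thesis
    using contd by (subst integral_completion) (auto intro: borel_measurable_continuous_onI)
qed

section \<open>Square integrable functions\<close>

text \<open>
  Integrals over a set are rewritten as integrals with respect to the restricted measure, to which the general
  lemmas on integrable functions apply directly.
\<close>

lemma set_lebesgue_integral_eq_lebesgue_on:
  fixes f :: "'a::euclidean_space \<Rightarrow> real"
  assumes "S \<in> sets lebesgue"
  shows "(LINT x:S|lebesgue. f x) = (LINT x|lebesgue_on S. f x)"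
  using assms by (simp add: set_lebesgue_integral_def integral_restrict_space)

lemma L2_iff:
  assumes "S \<in> sets lebesgue"
  shows "u \<in> L2 S \<longleftrightarrow> u \<in> borel_measurable (lebesgue_on S) \<and> integrable (lebesgue_on S) (\<lambda>x. (norm (u x))\<^sup>2)"
  using assms
  by (simp add: L2_def set_borel_measurable_def set_integrable_def borel_measurable_restrict_space_iff integrable_restrict_space)

lemma L2_inner_integrable:
  assumes S: "S \<in> sets lebesgue" and u: "u \<in> L2 S" and v: "v \<in> L2 S"
  shows "integrable (lebesgue_on S) (\<lambda>x. u x \<bullet> v x)"
proof (rule Bochner_Integration.integrable_bound)
  show "integrable (lebesgue_on S) (\<lambda>x. (norm (u x))\<^sup>2 + (norm (v x))\<^sup>2)"
    using u v by (auto simp: L2_iff[OF S])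
  show "(\<lambda>x. u x \<bullet> v x) \<in> borel_measurable (lebesgue_on S)"
    using u v by (auto simp: L2_iff[OF S] intro: borel_measurable_inner)
  have "\<bar>a \<bullet> b\<bar> \<le> (norm a)\<^sup>2 + (norm b)\<^sup>2" for a b :: 'b
    using Cauchy_Schwarz_ineq2[of a b] sum_squares_bound[of "norm a" "norm b"]
      mult_nonneg_nonneg[of "norm a" "norm b"] by (simp add: power2_eq_square)
  then show "AE x in lebesgue_on S. norm (u x \<bullet> v x) \<le> norm ((norm (u x))\<^sup>2 + (norm (v x))\<^sup>2)"
    by (auto intro!: AE_I2)
qed

lemma L2_times_integrable:
  fixes u v :: "real ^ 'n::finite \<Rightarrow> real"
  assumes "S \<in> sets lebesgue" "u \<in> L2 S" "v \<in> L2 S"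
  shows "integrable (lebesgue_on S) (\<lambda>x. u x * v x)"
  using L2_inner_integrable[OF assms] by simp

lemma norm_add_sq_le: "(norm (a + b))\<^sup>2 \<le> 2 * (norm a)\<^sup>2 + 2 * (norm b)\<^sup>2"
  for a b :: "'a::real_normed_vector"
proof -
  have "(norm (a + b))\<^sup>2 \<le> (norm a + norm b)\<^sup>2"
    by (intro power_mono norm_triangle_ineq) auto
  also have "\<dots> \<le> 2 * (norm a)\<^sup>2 + 2 * (norm b)\<^sup>2"
    using sum_squares_bound[of "norm a" "norm b"] by (simp add: power2_sum)
  finally show ?thesis .
qed

lemma L2_dominated:
  assumes S: "S \<in> sets lebesgue" and "u \<in> borel_measurable (lebesgue_on S)"
    and "integrable (lebesgue_on S) h" "\<And>x. x \<in> S \<Longrightarrow> (norm (u x))\<^sup>2 \<le> h x"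
  shows "u \<in> L2 S"
  unfolding L2_iff[OF S]
proof
  show "integrable (lebesgue_on S) (\<lambda>x. (norm (u x))\<^sup>2)"
  proof (rule Bochner_Integration.integrable_bound)
    show "AE x in lebesgue_on S. norm ((norm (u x))\<^sup>2) \<le> norm (h x)"
    proof (rule AE_I2)
      fix x assume "x \<in> space (lebesgue_on S)"
      then have "(norm (u x))\<^sup>2 \<le> h x" using assms(4) by simp
      then show "norm ((norm (u x))\<^sup>2) \<le> norm (h x)" by simp
    qed
  qed (use assms in auto)
qed (use assms in auto)

lemma L2_add:
  assumes S: "S \<in> sets lebesgue" and u: "u \<in> L2 S" and v: "v \<in> L2 S"
  shows "(\<lambda>x. u x + v x) \<in> L2 S"
proof (rule L2_dominated[OF S])
  show "integrable (lebesgue_on S) (\<lambda>x. 2 * (norm (u x))\<^sup>2 + 2 * (norm (v x))\<^sup>2)"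
    using u v by (auto simp: L2_iff[OF S])
qed (use u v norm_add_sq_le in \<open>auto simp: L2_iff[OF S]\<close>)

lemma L2_scaleR:
  assumes S: "S \<in> sets lebesgue" and u: "u \<in> L2 S"
  shows "(\<lambda>x. c *\<^sub>R u x) \<in> L2 S"
  using u by (auto simp: L2_iff[OF S] power_mult_distrib)

lemma L2_diff:
  assumes S: "S \<in> sets lebesgue" and u: "u \<in> L2 S" and v: "v \<in> L2 S"
  shows "(\<lambda>x. u x - v x) \<in> L2 S"
  using L2_add[OF S u L2_scaleR[OF S v, of "-1"]] by simp

lemma L2_nth:
  fixes g :: "real ^ 'n::finite \<Rightarrow> real ^ 'm::finite"
  assumes S: "S \<in> sets lebesgue" and g: "g \<in> L2 S"
  shows "(\<lambda>x. g x $ i) \<in> L2 S"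
proof (rule L2_dominated[OF S])
  show "(\<lambda>x. g x $ i) \<in> borel_measurable (lebesgue_on S)"
    using borel_measurable_inner[of g "lebesgue_on S" "\<lambda>x. axis i 1"] g
    by (simp add: L2_iff[OF S] inner_axis)
  show "(norm (g x $ i))\<^sup>2 \<le> (norm (g x))\<^sup>2" for x
    using component_le_norm_cart[of "g x" i] by (intro power_mono) auto
qed (use g in \<open>auto simp: L2_iff[OF S]\<close>)

lemma L2_bounded:
  assumes S: "S \<in> lmeasurable" and "u \<in> borel_measurable (lebesgue_on S)"
    and "\<And>x. x \<in> S \<Longrightarrow> norm (u x) \<le> C"
  shows "u \<in> L2 S"
proof (rule L2_dominated)
  interpret finite_measure "lebesgue_on S" using S by (rule finite_measure_lebesgue_on)
  show "integrable (lebesgue_on S) (\<lambda>x. C\<^sup>2)" by simp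
  show "(norm (u x))\<^sup>2 \<le> C\<^sup>2" if "x \<in> S" for x
    using assms(3)[OF that] by (intro power_mono) auto
qed (use assms in auto)

lemma L2_integrable:
  fixes u :: "real ^ 'n::finite \<Rightarrow> real"
  assumes S: "S \<in> lmeasurable" and u: "u \<in> L2 S"
  shows "integrable (lebesgue_on S) u"
proof -
  have "(\<lambda>x. 1::real) \<in> L2 S" using S by (rule L2_bounded[where C=1]) auto
  from L2_times_integrable[OF _ u this] S show ?thesis by auto
qed

lemma L2_mono:
  assumes "U \<subseteq> S" "U \<in> sets lebesgue" "S \<in> sets lebesgue" "u \<in> L2 S"
  shows "u \<in> L2 U"
  using assms unfolding L2_def
  by (auto intro: set_integrable_subset set_borel_measurable_subset)

lemma L2_continuous:
  fixes u :: "real ^ 'n::finite \<Rightarrow> 'b::euclidean_space"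
  assumes S: "bounded S" "S \<in> sets lebesgue" and u: "continuous_on UNIV u"
  shows "u \<in> L2 S"
proof -
  have "compact (u ` closure S)"
    using u S by (intro compact_continuous_image) (auto intro: continuous_on_subset)
  then obtain C where "\<And>x. x \<in> closure S \<Longrightarrow> norm (u x) \<le> C"
    using compact_imp_bounded bounded_iff by (metis image_eqI)
  moreover have "u \<in> borel_measurable (lebesgue_on S)"
    using u by (intro measurable_restrict_space1 measurable_completion) (auto intro: borel_measurable_continuous_onI)
  ultimately show ?thesis
    using S closure_subset by (intro L2_bounded[where C=C]) (auto intro: bounded_set_imp_lmeasurable)
qed

section \<open>Weak gradients\<close>

definition grad :: "(real ^ 'n::finite \<Rightarrow> real) \<Rightarrow> real ^ 'n \<Rightarrow> real ^ 'n" where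
  "grad f x = (\<chi> i. pd i f x)"

lemma continuous_on_grad: "Ck (Suc 0) f \<Longrightarrow> continuous_on UNIV (grad f)"
  unfolding grad_def by (auto intro!: continuous_intros)

lemma is_weak_grad_iff:
  assumes S: "S \<in> sets lebesgue"
  shows "is_weak_grad S u g \<longleftrightarrow> g \<in> L2 S \<and>
     (\<forall>\<phi>\<in>test_functions S. \<forall>i.
        (LINT x|lebesgue_on S. u x * pd i \<phi> x) = - (LINT x|lebesgue_on S. g x $ i * \<phi> x))"
  by (simp add: is_weak_grad_def set_lebesgue_integral_eq_lebesgue_on[OF S])

lemma test_function_L2:
  assumes "\<phi> \<in> test_functions S" "open S"
  shows "\<phi> \<in> L2 S" "pd i \<phi> \<in> L2 S"
proof -
  obtain C where C: "compact C" "C \<subseteq> S" "\<And>x. x \<notin> C \<Longrightarrow> \<phi> x = 0"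
    using assms test_functionsE by metis
  have K: "u \<in> L2 S" if u: "continuous_on UNIV u" "\<And>x. x \<notin> C \<Longrightarrow> u x = 0" for u :: "real ^ 'a \<Rightarrow> real"
  proof -
    have "u \<in> L2 C" using C u
      by (intro L2_continuous) (auto intro: compact_imp_bounded lmeasurable_compact fmeasurableD)
    moreover have "(\<lambda>x. indicator C x * u x) = u" "(\<lambda>x. indicator S x * u x) = u"
      "(\<lambda>x. indicator C x * (u x)\<^sup>2) = (\<lambda>x. (u x)\<^sup>2)" "(\<lambda>x. indicator S x * (u x)\<^sup>2) = (\<lambda>x. (u x)\<^sup>2)"
      using u(2) C(2) by (auto simp: fun_eq_iff indicator_def) 
    ultimately show ?thesis unfolding L2_def set_borel_measurable_def set_integrable_def by simp
  qed
  have "continuous_on UNIV \<phi>" "continuous_on UNIV (pd i \<phi>)"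
    using test_functions_Ck[OF assms(1), of 0] test_functions_Ck[OF assms(1), of "Suc 0"] by auto
  then show "\<phi> \<in> L2 S" "pd i \<phi> \<in> L2 S"
    by (auto intro!: K C(3) pd_eq_0_outside[of C] compact_imp_closed C(1))
qed

lemma grad_L2:
  assumes "open S" "bounded S" "Ck (Suc 0) p"
  shows "p \<in> L2 S" "grad p \<in> L2 S"
  using assms Ck_SucD[OF assms(3)] by (auto intro!: L2_continuous continuous_on_grad)

text \<open>
  One lemma for affine functions, coordinates, constants and test functions: apply \<open>integral_pd_eq_0\<close> to the product with
  a test function.
\<close>

lemma is_weak_grad_C1:
  fixes p :: "real ^ 'n::finite \<Rightarrow> real"
  assumes S: "open S" "bounded S" and p: "Ck (Suc 0) p"
  shows "is_weak_grad S p (grad p)"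
proof -
  have SL: "S \<in> sets lebesgue" using S by auto
  have "(LINT x|lebesgue_on S. p x * pd i \<phi> x) = - (LINT x|lebesgue_on S. grad p x $ i * \<phi> x)"
    if \<phi>: "\<phi> \<in> test_functions S" for \<phi> i
  proof -
    obtain C where C: "compact C" "C \<subseteq> S" "\<And>x. x \<notin> C \<Longrightarrow> \<phi> x = 0"
      using \<phi> test_functionsE by metis
    have \<phi>1: "Ck (Suc 0) \<phi>" using \<phi> test_functions_Ck by blast
    have i: "integrable (lebesgue_on S) (\<lambda>x. p x * pd i \<phi> x)"
        "integrable (lebesgue_on S) (\<lambda>x. grad p x $ i * \<phi> x)"
      using grad_L2[OF S p] test_function_L2[OF \<phi> S(1)]
      by (auto intro!: L2_times_integrable[OF SL] L2_nth[OF SL])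
    have "pd i (\<lambda>x. p x * \<phi> x) x = p x * pd i \<phi> x + pd i p x * \<phi> x" for x
      using p \<phi>1 by (intro pd_mult) auto
    then have "(LINT x|lebesgue_on S. p x * pd i \<phi> x) + (LINT x|lebesgue_on S. grad p x $ i * \<phi> x)
        = (LINT x|lebesgue_on S. pd i (\<lambda>x. p x * \<phi> x) x)"
      using i by (simp add: grad_def)
    also have "\<dots> = (LINT x|lebesgue. pd i (\<lambda>x. p x * \<phi> x) x)"
    proof -
      have "pd i (\<lambda>x. p x * \<phi> x) x = 0" if "x \<notin> C" for x
        using that C by (intro pd_eq_0_outside[of C]) (auto intro: compact_imp_closed)
      then have "(\<lambda>x. indicator S x *\<^sub>R pd i (\<lambda>x. p x * \<phi> x) x) = pd i (\<lambda>x. p x * \<phi> x)"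
        using C(2) by (auto simp: fun_eq_iff indicator_def)
      then show ?thesis using SL by (simp add: integral_restrict_space)
    qed
    also have "\<dots> = 0"
      using C by (intro integral_pd_eq_0[of _ C] Ck_mult p \<phi>1) auto
    finally show ?thesis by simp
  qed
  then show ?thesis using grad_L2[OF S p] by (simp add: is_weak_grad_iff[OF SL])
qed

lemma is_weak_grad_cong:
  assumes "is_weak_grad S u g" "\<And>x. x \<in> S \<Longrightarrow> u x = u' x"
  shows "is_weak_grad S u' g"
proof -
  have "(LINT x:S|lebesgue. u x * h x) = (LINT x:S|lebesgue. u' x * h x)" for h
    unfolding set_lebesgue_integral_def using assms(2)
    by (intro Bochner_Integration.integral_cong) (auto simp: indicator_def)
  with assms(1) show ?thesis by (simp add: is_weak_grad_def)
qed

lemma is_weak_grad_lincomb: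
  assumes S: "open S" and u: "u \<in> L2 S" "is_weak_grad S u g" and v: "v \<in> L2 S" "is_weak_grad S v h"
  shows "is_weak_grad S (\<lambda>x. a * u x + b * v x) (\<lambda>x. a *\<^sub>R g x + b *\<^sub>R h x)"
proof -
  have SL: "S \<in> sets lebesgue" using S by auto
  have g: "g \<in> L2 S" and h: "h \<in> L2 S" using u v by (auto simp: is_weak_grad_def)
  have "(LINT x|lebesgue_on S. (a * u x + b * v x) * pd i \<phi> x) =
       - (LINT x|lebesgue_on S. (a *\<^sub>R g x + b *\<^sub>R h x) $ i * \<phi> x)"
    if \<phi>: "\<phi> \<in> test_functions S" for \<phi> i
  proof -
    note \<phi>L = test_function_L2[OF \<phi> S]
    have i: "integrable (lebesgue_on S) (\<lambda>x. u x * pd i \<phi> x)" "integrable (lebesgue_on S) (\<lambda>x. v x * pd i \<phi> x)"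
       "integrable (lebesgue_on S) (\<lambda>x. g x $ i * \<phi> x)" "integrable (lebesgue_on S) (\<lambda>x. h x $ i * \<phi> x)"
      using u v g h \<phi>L by (auto intro!: L2_times_integrable[OF SL] L2_nth[OF SL])
    have "(LINT x|lebesgue_on S. (a * u x + b * v x) * pd i \<phi> x)
       = a * (LINT x|lebesgue_on S. u x * pd i \<phi> x) + b * (LINT x|lebesgue_on S. v x * pd i \<phi> x)"
      using i by (simp add: distrib_right mult.assoc)
    also have "\<dots> = - (a * (LINT x|lebesgue_on S. g x $ i * \<phi> x) + b * (LINT x|lebesgue_on S. h x $ i * \<phi> x))"
      using u(2) v(2) \<phi> by (simp add: is_weak_grad_iff[OF SL])
    also have "\<dots> = - (LINT x|lebesgue_on S. (a *\<^sub>R g x + b *\<^sub>R h x) $ i * \<phi> x)"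
      using i by (simp add: distrib_right mult.assoc)
    finally show ?thesis .
  qed
  moreover have "(\<lambda>x. a *\<^sub>R g x + b *\<^sub>R h x) \<in> L2 S"
    using g h by (intro L2_add L2_scaleR SL)
  ultimately show ?thesis by (simp add: is_weak_grad_iff[OF SL])
qed

lemma is_weak_grad_mono:
  assumes "open U" "open S" "U \<subseteq> S" and g: "is_weak_grad S u g"
  shows "is_weak_grad U u g"
proof -
  have SL: "S \<in> sets lebesgue" "U \<in> sets lebesgue" using assms by auto
  have "(LINT x|lebesgue_on U. u x * pd i \<phi> x) = - (LINT x|lebesgue_on U. g x $ i * \<phi> x)"
    if \<phi>: "\<phi> \<in> test_functions U" for \<phi> i
  proof -
    obtain C where C: "compact C" "C \<subseteq> U" "\<And>x. x \<notin> C \<Longrightarrow> \<phi> x = 0"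
      using \<phi> test_functionsE by metis
    have Cd: "pd i \<phi> x = 0" if "x \<notin> C" for x
      using that C by (intro pd_eq_0_outside[of C]) (auto intro: compact_imp_closed)
    have "(LINT x|lebesgue_on U. k x * h x) = (LINT x|lebesgue_on S. k x * h x)"
      if "\<And>x. x \<notin> C \<Longrightarrow> h x = 0" for k h :: "real ^ 'a \<Rightarrow> real"
    proof -
      have "(\<lambda>x. indicator U x *\<^sub>R (k x * h x)) = (\<lambda>x. indicator S x *\<^sub>R (k x * h x))"
        using that C(2) \<open>U \<subseteq> S\<close> by (auto simp: fun_eq_iff indicator_def)
      then show ?thesis using SL by (simp add: integral_restrict_space del: real_scaleR_def)
    qed
    moreover have "\<phi> \<in> test_functions S" using \<phi> test_functions_mono[OF \<open>U \<subseteq> S\<close>] by auto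
    ultimately show ?thesis
      using g C Cd by (simp add: is_weak_grad_iff[OF SL(1)])
  qed
  moreover have "g \<in> L2 U" using g L2_mono[OF \<open>U \<subseteq> S\<close> SL(2,1)] by (auto simp: is_weak_grad_def)
  ultimately show ?thesis by (simp add: is_weak_grad_iff[OF SL(2)])
qed

lemma is_weak_grad_unique:
  fixes g h :: "real ^ 'n::finite \<Rightarrow> real ^ 'n"
  assumes S: "open S" "bounded S" and g: "is_weak_grad S u g" and h: "is_weak_grad S u h"
  shows "AE x in lebesgue_on S. g x = h x"
proof -
  have SL: "S \<in> sets lebesgue" "S \<in> lmeasurable" using S by (auto intro: bounded_set_imp_lmeasurable)
  have L: "g \<in> L2 S" "h \<in> L2 S" using g h by (auto simp: is_weak_grad_def)
  have "AE x in lebesgue_on S. g x $ i - h x $ i = 0" for i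
  proof (rule fundamental_lemma[OF S(1)])
    show "integrable (lebesgue_on S) (\<lambda>x. g x $ i - h x $ i)"
      using L by (intro L2_integrable SL L2_diff L2_nth)
    fix \<phi> assume \<phi>: "\<phi> \<in> test_functions S"
    have "integrable (lebesgue_on S) (\<lambda>x. g x $ i * \<phi> x)" "integrable (lebesgue_on S) (\<lambda>x. h x $ i * \<phi> x)"
      using L test_function_L2[OF \<phi> S(1)] by (auto intro!: L2_times_integrable SL L2_nth)
    then show "(LINT x|lebesgue_on S. (g x $ i - h x $ i) * \<phi> x) = 0"
      using g h \<phi> by (simp add: left_diff_distrib is_weak_grad_iff[OF SL(1)])
  qed
  then have "AE x in lebesgue_on S. \<forall>i. g x $ i - h x $ i = 0"
    by (subst AE_all_countable) (auto intro: countable_finite)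
  then show ?thesis by eventually_elim (simp add: vec_eq_iff)
qed

lemma wgrad_is_weak_grad: "u \<in> H1 S \<Longrightarrow> is_weak_grad S u (wgrad S u)"
  unfolding H1_def wgrad_def by (auto intro: someI[of "is_weak_grad S u"])

lemma wgrad_AE:
  assumes "open S" "bounded S" "is_weak_grad S u g"
  shows "AE x in lebesgue_on S. wgrad S u x = g x"
proof -
  have "is_weak_grad S u (wgrad S u)" using someI[of "is_weak_grad S u", OF assms(3)] by (simp add: wgrad_def)
  with assms show ?thesis by (intro is_weak_grad_unique)
qed

section \<open>The bilinear forms\<close>

lemma matrix_vector_norm_le:
  fixes B :: "real ^ 'n::finite ^ 'n"
  shows "norm (B *v p) \<le> real CARD('n) * real CARD('n) * norm B * norm p"
proof -
  have "\<bar>B $ i $ j\<bar> \<le> norm B" for i j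
    using component_le_norm_cart[of "B $ i" j] Finite_Cartesian_Product.norm_nth_le[of B i] by linarith
  then have "onorm ((*v) B) \<le> real CARD('n) * real CARD('n) * norm B"
    by (rule onorm_le_matrix_component)
  moreover have "norm (B *v p) \<le> onorm ((*v) B) * norm p"
    by (rule onorm) simp
  ultimately show ?thesis by (meson mult_right_mono norm_ge_zero order_trans)
qed

lemma form_integrable:
  fixes B :: "real ^ 'n::finite \<Rightarrow> real ^ 'n ^ 'n"
  assumes S: "S \<in> sets lebesgue" and B: "B \<in> Linfty S" and p: "p \<in> L2 S" and q: "q \<in> L2 S"
  shows "integrable (lebesgue_on S) (\<lambda>x. q x \<bullet> (B x *v p x))"
proof -
  let ?c = "real CARD('n) * real CARD('n)"
  have Bm[measurable]: "B \<in> borel_measurable (lebesgue_on S)"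
    using B S by (simp add: Linfty_def set_borel_measurable_def borel_measurable_restrict_space_iff)
  obtain C where C: "AE x in lebesgue. x \<in> S \<longrightarrow> norm (B x) \<le> C"
    using B by (auto simp: Linfty_def)
  then have C: "AE x in lebesgue_on S. norm (B x) \<le> C"
    using S by (simp add: AE_restrict_space_iff)
  have pm[measurable]: "p \<in> borel_measurable (lebesgue_on S)" and qm: "q \<in> borel_measurable (lebesgue_on S)"
    using p q by (auto simp: L2_iff[OF S])
  have "continuous_on UNIV (\<lambda>z :: (real ^ 'n ^ 'n) \<times> (real ^ 'n). fst z *v snd z)"
    unfolding matrix_vector_mult_def by (intro continuous_intros)
  then have "(\<lambda>x. B x *v p x) \<in> borel_measurable (lebesgue_on S)"
    by (intro borel_measurable_continuous_Pair[OF Bm pm])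
  then have m: "(\<lambda>x. q x \<bullet> (B x *v p x)) \<in> borel_measurable (lebesgue_on S)"
    using qm by (intro borel_measurable_inner)
  show ?thesis
  proof (rule Bochner_Integration.integrable_bound)
    show "integrable (lebesgue_on S) (\<lambda>x. ?c * C * ((norm (q x))\<^sup>2 + (norm (p x))\<^sup>2))"
      using p q by (auto simp: L2_iff[OF S])
    show "AE x in lebesgue_on S. norm (q x \<bullet> (B x *v p x)) \<le> norm (?c * C * ((norm (q x))\<^sup>2 + (norm (p x))\<^sup>2))"
      using C
    proof eventually_elim
      fix x assume *: "norm (B x) \<le> C"
      then have "0 \<le> C" using norm_ge_zero[of "B x"] by linarith
      have "\<bar>q x \<bullet> (B x *v p x)\<bar> \<le> norm (q x) * (?c * norm (B x) * norm (p x))"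
        using Cauchy_Schwarz_ineq2[of "q x" "B x *v p x"] matrix_vector_norm_le[of "B x" "p x"]
        by (meson mult_left_mono norm_ge_zero order_trans)
      also have "\<dots> \<le> norm (q x) * (?c * C * norm (p x))"
        using * by (intro mult_left_mono mult_right_mono) auto
      also have "\<dots> = ?c * C * (norm (q x) * norm (p x))" by simp
      also have "\<dots> \<le> ?c * C * ((norm (q x))\<^sup>2 + (norm (p x))\<^sup>2)"
      proof (rule mult_left_mono)
        have "0 \<le> norm (q x) * norm (p x)" by simp
        then show "norm (q x) * norm (p x) \<le> (norm (q x))\<^sup>2 + (norm (p x))\<^sup>2"
          using sum_squares_bound[of "norm (q x)" "norm (p x)"] by linarith
      qed (use \<open>0 \<le> C\<close> in simp)
      finally show "norm (q x \<bullet> (B x *v p x)) \<le> norm (?c * C * ((norm (q x))\<^sup>2 + (norm (p x))\<^sup>2))"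
        by simp
    qed
  qed (rule m)
qed

text \<open>
  The form may be computed with any weak gradients, not only with the chosen ones in its definition.
\<close>

lemma bform_eq:
  fixes B :: "real ^ 'n::finite \<Rightarrow> real ^ 'n ^ 'n"
  assumes S: "open S" "bounded S" and B: "B \<in> Linfty S"
    and p: "is_weak_grad S u p" and q: "is_weak_grad S v q"
  shows "bform S B u v = (LINT x|lebesgue_on S. q x \<bullet> (B x *v p x))"
proof -
  have SL: "S \<in> sets lebesgue" using S by auto
  have p': "is_weak_grad S u (wgrad S u)" and q': "is_weak_grad S v (wgrad S v)"
    using someI[of "is_weak_grad S u", OF p] someI[of "is_weak_grad S v", OF q] by (auto simp: wgrad_def)
  have "(LINT x|lebesgue_on S. wgrad S v x \<bullet> (B x *v wgrad S u x)) = (LINT x|lebesgue_on S. q x \<bullet> (B x *v p x))"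
  proof (rule integral_cong_AE)
    show "AE x in lebesgue_on S. wgrad S v x \<bullet> (B x *v wgrad S u x) = q x \<bullet> (B x *v p x)"
      using wgrad_AE[OF S p] wgrad_AE[OF S q] by eventually_elim simp
  qed (use p q p' q' in \<open>auto simp: is_weak_grad_def intro!: borel_measurable_integrable form_integrable[OF SL B]\<close>)
  then show ?thesis by (simp add: bform_def set_lebesgue_integral_eq_lebesgue_on[OF SL])
qed

text \<open>
  Coercivity is assumed for each vector separately, with an exceptional null set that depends on the vector. A
  countable dense set of vectors and continuity give one null set for all vectors, which is needed to insert a
  gradient that depends on the point.
\<close>

lemma coercive_AE:
  fixes A :: "real ^ 'n::finite \<Rightarrow> real ^ 'n ^ 'n"
  assumes S: "S \<in> sets lebesgue" "S \<subseteq> \<Omega>"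
    and c: "\<forall>\<xi>. AE x in lebesgue. x \<in> \<Omega> \<longrightarrow> m * (norm \<xi>)\<^sup>2 \<le> \<xi> \<bullet> (A x *v \<xi>)"
  shows "AE x in lebesgue_on S. \<forall>\<xi>. m * (norm \<xi>)\<^sup>2 \<le> \<xi> \<bullet> (A x *v \<xi>)"
proof -
  obtain D :: "(real ^ 'n) set" where D: "countable D" "\<And>X. open X \<Longrightarrow> X \<noteq> {} \<Longrightarrow> \<exists>d\<in>D. d \<in> X"
    using countable_dense_setE by blast
  have "AE x in lebesgue_on S. m * (norm \<xi>)\<^sup>2 \<le> \<xi> \<bullet> (A x *v \<xi>)" for \<xi>
  proof -
    have "AE x in lebesgue. x \<in> S \<longrightarrow> m * (norm \<xi>)\<^sup>2 \<le> \<xi> \<bullet> (A x *v \<xi>)"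
      using c[rule_format, of \<xi>] by eventually_elim (use S in auto)
    then show ?thesis using S by (simp add: AE_restrict_space_iff)
  qed
  then have "AE x in lebesgue_on S. \<forall>\<xi>\<in>D. m * (norm \<xi>)\<^sup>2 \<le> \<xi> \<bullet> (A x *v \<xi>)"
    using D(1) by (subst AE_ball_countable) auto
  then show ?thesis
  proof eventually_elim
    fix x assume *: "\<forall>\<xi>\<in>D. m * (norm \<xi>)\<^sup>2 \<le> \<xi> \<bullet> (A x *v \<xi>)"
    let ?X = "{\<xi>. \<xi> \<bullet> (A x *v \<xi>) < m * (norm \<xi>)\<^sup>2}"
    have "continuous_on UNIV (\<lambda>\<xi>. A x *v \<xi>)"
      by (intro linear_continuous_on) simp
    then have "open ?X" by (intro open_Collect_less continuous_intros)
    with D(2)[of ?X] * have "?X = {}" by (metis (mono_tags, lifting) mem_Collect_eq not_less)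
    then show "\<forall>\<xi>. m * (norm \<xi>)\<^sup>2 \<le> \<xi> \<bullet> (A x *v \<xi>)" by (auto simp: not_less)
  qed
qed

lemma grad_AE_zero_if_energy_zero:
  fixes A :: "real ^ 'n::finite \<Rightarrow> real ^ 'n ^ 'n"
  assumes S: "S \<in> sets lebesgue" and m: "0 < m"
    and c: "AE x in lebesgue_on S. \<forall>\<xi>. m * (norm \<xi>)\<^sup>2 \<le> \<xi> \<bullet> (A x *v \<xi>)"
    and A: "A \<in> Linfty S" and p: "p \<in> L2 S"
    and 0: "(LINT x|lebesgue_on S. p x \<bullet> (A x *v p x)) \<le> 0"
  shows "AE x in lebesgue_on S. p x = 0"
proof -
  have nn: "AE x in lebesgue_on S. 0 \<le> p x \<bullet> (A x *v p x)"
    using c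
  proof eventually_elim
    fix x assume "\<forall>\<xi>. m * (norm \<xi>)\<^sup>2 \<le> \<xi> \<bullet> (A x *v \<xi>)"
    then have "m * (norm (p x))\<^sup>2 \<le> p x \<bullet> (A x *v p x)" by blast
    moreover have "0 \<le> m * (norm (p x))\<^sup>2" using m by simp
    ultimately show "0 \<le> p x \<bullet> (A x *v p x)" by linarith
  qed
  have "AE x in lebesgue_on S. p x \<bullet> (A x *v p x) = 0"
    using integral_nonneg_eq_0_iff_AE[OF form_integrable[OF S A p p] nn] 0 integral_nonneg_AE[OF nn] by simp
  with c show ?thesis
  proof eventually_elim
    fix x assume "\<forall>\<xi>. m * (norm \<xi>)\<^sup>2 \<le> \<xi> \<bullet> (A x *v \<xi>)" "p x \<bullet> (A x *v p x) = 0"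
    then have "m * (norm (p x))\<^sup>2 \<le> 0" by metis
    with m show "p x = 0" by (simp add: mult_le_0_iff)
  qed
qed

section \<open>Functions with zero boundary values\<close>

lemma H1_norm_eq:
  assumes S: "open S" "bounded S" and g: "is_weak_grad S u g"
  shows "H1_norm S u = sqrt ((LINT x|lebesgue_on S. (u x)\<^sup>2) + (LINT x|lebesgue_on S. (norm (g x))\<^sup>2))"
proof -
  have SL: "S \<in> sets lebesgue" using S by auto
  have g': "is_weak_grad S u (wgrad S u)"
    using someI[of "is_weak_grad S u", OF g] by (simp add: wgrad_def)
  have "(LINT x|lebesgue_on S. (norm (wgrad S u x))\<^sup>2) = (LINT x|lebesgue_on S. (norm (g x))\<^sup>2)"
  proof (rule integral_cong_AE)
    show "AE x in lebesgue_on S. (norm (wgrad S u x))\<^sup>2 = (norm (g x))\<^sup>2"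
      using wgrad_AE[OF S g] by eventually_elim simp
  qed (use g g' in \<open>auto simp: is_weak_grad_def L2_iff[OF SL]\<close>)
  then show ?thesis by (simp add: H1_norm_def set_lebesgue_integral_eq_lebesgue_on[OF SL])
qed

lemma is_weak_grad_minus_test:
  assumes S: "open S" "bounded S" and u: "u \<in> L2 S" "is_weak_grad S u g" and \<phi>: "\<phi> \<in> test_functions S"
  shows "is_weak_grad S (\<lambda>x. u x - \<phi> x) (\<lambda>x. g x - grad \<phi> x)"
  using is_weak_grad_lincomb[OF S(1) u test_function_L2(1)[OF \<phi> S(1)] is_weak_grad_C1[OF S test_functions_Ck[OF \<phi>]],
      of 1 "-1"] by simp

text \<open>
  Convergence in \<open>H\<^sup>1\<close>, split into its two summands and expressed with a given weak gradient \<open>g\<close> of the limit;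
  this keeps the choice operator in \<open>H1_norm\<close> out of the estimates.
\<close>

definition approximates_in_H1 ::
  "(real ^ 'n::finite) set \<Rightarrow> (nat \<Rightarrow> real ^ 'n \<Rightarrow> real) \<Rightarrow> (real ^ 'n \<Rightarrow> real) \<Rightarrow> (real ^ 'n \<Rightarrow> real ^ 'n) \<Rightarrow> bool" where
  "approximates_in_H1 S \<phi> u g \<longleftrightarrow> (\<forall>k. \<phi> k \<in> test_functions S) \<and>
     (\<lambda>k. LINT x|lebesgue_on S. (u x - \<phi> k x)\<^sup>2) \<longlonglongrightarrow> 0 \<and>
     (\<lambda>k. LINT x|lebesgue_on S. (norm (g x - grad (\<phi> k) x))\<^sup>2) \<longlonglongrightarrow> 0"

lemma H10D:
  assumes "u \<in> H10 S"
  shows "u \<in> L2 S" "is_weak_grad S u (wgrad S u)"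
  using assms wgrad_is_weak_grad by (auto simp: H10_def H1_def)

lemma H10E:
  assumes S: "open S" "bounded S" and u: "u \<in> H10 S" and g: "is_weak_grad S u g"
  obtains \<phi> where "approximates_in_H1 S \<phi> u g"
proof -
  obtain \<phi> where \<phi>: "\<And>k. \<phi> k \<in> test_functions S"
    and lim: "(\<lambda>k. H1_norm S (\<lambda>x. u x - \<phi> k x)) \<longlonglongrightarrow> 0"
    using u by (auto simp: H10_def)
  let ?a = "\<lambda>k. LINT x|lebesgue_on S. (u x - \<phi> k x)\<^sup>2"
  let ?b = "\<lambda>k. LINT x|lebesgue_on S. (norm (g x - grad (\<phi> k) x))\<^sup>2"
  have nn: "0 \<le> ?a k" "0 \<le> ?b k" for k by auto
  have "H1_norm S (\<lambda>x. u x - \<phi> k x) = sqrt (?a k + ?b k)" for k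
    by (rule H1_norm_eq[OF S is_weak_grad_minus_test[OF S H10D(1)[OF u] g \<phi>]])
  with lim have "(\<lambda>k. (sqrt (?a k + ?b k))\<^sup>2) \<longlonglongrightarrow> 0\<^sup>2"
    by (intro tendsto_power) simp
  then have s: "(\<lambda>k. ?a k + ?b k) \<longlonglongrightarrow> 0" using nn by simp
  have "?a \<longlonglongrightarrow> 0" "?b \<longlonglongrightarrow> 0"
    using nn by (auto intro: tendsto_sandwich[OF _ _ tendsto_const s])
  with \<phi> show ?thesis by (intro that[of \<phi>]) (simp add: approximates_in_H1_def)
qed

lemma H10I:
  assumes S: "open S" "bounded S" and u: "u \<in> L2 S" "is_weak_grad S u g" and \<phi>: "approximates_in_H1 S \<phi> u g"
  shows "u \<in> H10 S"
proof -
  have "H1_norm S (\<lambda>x. u x - \<phi> k x) =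
      sqrt ((LINT x|lebesgue_on S. (u x - \<phi> k x)\<^sup>2) + (LINT x|lebesgue_on S. (norm (g x - grad (\<phi> k) x))\<^sup>2))" for k
    using \<phi> unfolding approximates_in_H1_def by (intro H1_norm_eq[OF S is_weak_grad_minus_test[OF S u]]) auto
  moreover have "(\<lambda>k. sqrt ((LINT x|lebesgue_on S. (u x - \<phi> k x)\<^sup>2) + (LINT x|lebesgue_on S. (norm (g x - grad (\<phi> k) x))\<^sup>2))) \<longlonglongrightarrow> sqrt (0 + 0)"
    using \<phi> unfolding approximates_in_H1_def by (intro tendsto_intros) auto
  ultimately show ?thesis
    using u \<phi> unfolding approximates_in_H1_def H10_def H1_def by auto
qed

lemma grad_lincomb:
  assumes "Ck (Suc 0) f" "Ck (Suc 0) g"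
  shows "grad (\<lambda>x. a * f x + b * g x) x = a *\<^sub>R grad f x + b *\<^sub>R grad g x"
proof -
  have "(\<lambda>x. c * h x) differentiable (at x) \<and> pd i (\<lambda>x. c * h x) x = c * pd i h x"
    if "h differentiable (at x)" for c h i
    using pd_mult[OF differentiable_const that, where i=i] that by (auto simp: pd_const)
  then show ?thesis
    using assms by (auto simp: grad_def vec_eq_iff pd_add)
qed

lemma tendsto_0_L2_lincomb:
  fixes f g :: "nat \<Rightarrow> real ^ 'n::finite \<Rightarrow> 'b::euclidean_space"
  assumes S: "S \<in> sets lebesgue" and L: "\<And>k. f k \<in> L2 S" "\<And>k. g k \<in> L2 S"
    and lim: "(\<lambda>k. LINT x|lebesgue_on S. (norm (f k x))\<^sup>2) \<longlonglongrightarrow> 0"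
       "(\<lambda>k. LINT x|lebesgue_on S. (norm (g k x))\<^sup>2) \<longlonglongrightarrow> 0"
  shows "(\<lambda>k. LINT x|lebesgue_on S. (norm (a *\<^sub>R f k x + b *\<^sub>R g k x))\<^sup>2) \<longlonglongrightarrow> 0"
proof (rule tendsto_sandwich[OF _ _ tendsto_const])
  let ?F = "\<lambda>k. LINT x|lebesgue_on S. (norm (f k x))\<^sup>2"
  let ?G = "\<lambda>k. LINT x|lebesgue_on S. (norm (g k x))\<^sup>2"
  have "(\<lambda>k. 2 * a\<^sup>2 * ?F k + 2 * b\<^sup>2 * ?G k) \<longlonglongrightarrow> 2 * a\<^sup>2 * 0 + 2 * b\<^sup>2 * 0"
    by (intro tendsto_intros lim)
  then show "(\<lambda>k. 2 * a\<^sup>2 * ?F k + 2 * b\<^sup>2 * ?G k) \<longlonglongrightarrow> 0" by simp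
  have "(LINT x|lebesgue_on S. (norm (a *\<^sub>R f k x + b *\<^sub>R g k x))\<^sup>2)
      \<le> (LINT x|lebesgue_on S. 2 * a\<^sup>2 * (norm (f k x))\<^sup>2 + 2 * b\<^sup>2 * (norm (g k x))\<^sup>2)" for k
  proof (rule integral_mono)
    show "integrable (lebesgue_on S) (\<lambda>x. (norm (a *\<^sub>R f k x + b *\<^sub>R g k x))\<^sup>2)"
      using L2_add[OF S L2_scaleR[OF S L(1)] L2_scaleR[OF S L(2)]] by (simp add: L2_iff[OF S])
    show "(norm (a *\<^sub>R f k x + b *\<^sub>R g k x))\<^sup>2 \<le> 2 * a\<^sup>2 * (norm (f k x))\<^sup>2 + 2 * b\<^sup>2 * (norm (g k x))\<^sup>2" for x
      using norm_add_sq_le[of "a *\<^sub>R f k x" "b *\<^sub>R g k x"] by (simp add: power_mult_distrib)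
  qed (use L in \<open>auto simp: L2_iff[OF S]\<close>)
  also have "\<dots> k = 2 * a\<^sup>2 * ?F k + 2 * b\<^sup>2 * ?G k" for k
    using L by (simp add: L2_iff[OF S])
  finally show "\<forall>\<^sub>F k in sequentially. (LINT x|lebesgue_on S. (norm (a *\<^sub>R f k x + b *\<^sub>R g k x))\<^sup>2) \<le> 2 * a\<^sup>2 * ?F k + 2 * b\<^sup>2 * ?G k"
    by simp
qed auto

lemma H10_lincomb:
  assumes S: "open S" "bounded S" and u: "u \<in> H10 S" and v: "v \<in> H10 S"
  shows "(\<lambda>x. a * u x + b * v x) \<in> H10 S"
proof -
  have SL: "S \<in> sets lebesgue" using S by auto
  let ?g = "wgrad S u" and ?h = "wgrad S v"
  note uL = H10D[OF u] and vL = H10D[OF v]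
  obtain \<phi> where \<phi>: "approximates_in_H1 S \<phi> u ?g" using H10E[OF S u uL(2)] .
  obtain \<psi> where \<psi>: "approximates_in_H1 S \<psi> v ?h" using H10E[OF S v vL(2)] .
  have t: "\<phi> k \<in> test_functions S" "\<psi> k \<in> test_functions S" for k
    using \<phi> \<psi> by (auto simp: approximates_in_H1_def)
  have gh: "?g \<in> L2 S" "?h \<in> L2 S" using uL vL by (auto simp: is_weak_grad_def)
  let ?\<chi> = "\<lambda>k x. a * \<phi> k x + b * \<psi> k x"
  have "(\<lambda>k. LINT x|lebesgue_on S. (norm (a *\<^sub>R (u x - \<phi> k x) + b *\<^sub>R (v x - \<psi> k x)))\<^sup>2) \<longlonglongrightarrow> 0"
    using \<phi> \<psi> L2_diff[OF SL uL(1) test_function_L2(1)[OF t(1) S(1)]] L2_diff[OF SL vL(1) test_function_L2(1)[OF t(2) S(1)]]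
    by (intro tendsto_0_L2_lincomb[OF SL]) (simp_all add: approximates_in_H1_def)
  moreover have "a *\<^sub>R (u x - \<phi> k x) + b *\<^sub>R (v x - \<psi> k x) = a * u x + b * v x - ?\<chi> k x" for k x
    by (simp add: algebra_simps)
  moreover have "(\<lambda>k. LINT x|lebesgue_on S. (norm (a *\<^sub>R (?g x - grad (\<phi> k) x) + b *\<^sub>R (?h x - grad (\<psi> k) x)))\<^sup>2) \<longlonglongrightarrow> 0"
    using \<phi> \<psi> L2_diff[OF SL gh(1) grad_L2(2)[OF S test_functions_Ck[OF t(1)]]]
      L2_diff[OF SL gh(2) grad_L2(2)[OF S test_functions_Ck[OF t(2)]]]
    by (intro tendsto_0_L2_lincomb[OF SL]) (simp_all add: approximates_in_H1_def)
  moreover have "a *\<^sub>R (?g x - grad (\<phi> k) x) + b *\<^sub>R (?h x - grad (\<psi> k) x) = a *\<^sub>R ?g x + b *\<^sub>R ?h x - grad (?\<chi> k) x" for k x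
    by (subst grad_lincomb[OF test_functions_Ck[OF t(1)] test_functions_Ck[OF t(2)]]) (simp add: algebra_simps)
  moreover have "?\<chi> k \<in> test_functions S" for k
    using t by (intro test_functions_add test_functions_Ck_mult Ck_const)
  ultimately have "approximates_in_H1 S ?\<chi> (\<lambda>x. a * u x + b * v x) (\<lambda>x. a *\<^sub>R ?g x + b *\<^sub>R ?h x)"
    by (simp add: approximates_in_H1_def)
  moreover have "(\<lambda>x. a * u x + b * v x) \<in> L2 S"
    using L2_add[OF SL L2_scaleR[OF SL uL(1)] L2_scaleR[OF SL vL(1)]] by simp
  moreover have "is_weak_grad S (\<lambda>x. a * u x + b * v x) (\<lambda>x. a *\<^sub>R ?g x + b *\<^sub>R ?h x)"
    using uL vL by (intro is_weak_grad_lincomb S)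
  ultimately show ?thesis using H10I[OF S] by blast
qed

lemma H10_0:
  assumes S: "open S" "bounded S"
  shows "(\<lambda>x. 0) \<in> H10 S"
proof -
  have "grad (\<lambda>x. 0) x = 0" for x :: "real ^ 'a" by (simp add: grad_def pd_const vec_eq_iff)
  then have "approximates_in_H1 S (\<lambda>k x. 0) (\<lambda>x. 0) (grad (\<lambda>x. 0))"
    by (simp add: approximates_in_H1_def test_functions_0)
  then show ?thesis
    using is_weak_grad_C1[OF S Ck_const] test_function_L2[OF test_functions_0 S(1)] by (intro H10I S)
qed

lemma H10_sum:
  assumes S: "open S" "bounded S" and "finite I" "\<And>i. i \<in> I \<Longrightarrow> u i \<in> H10 S"
  shows "(\<lambda>x. \<Sum>i\<in>I. c i * u i x) \<in> H10 S"
  using assms(3,4)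
proof (induction I rule: finite_induct)
  case (insert j I)
  then have "(\<lambda>x. c j * u j x + 1 * (\<Sum>i\<in>I. c i * u i x)) \<in> H10 S"
    by (intro H10_lincomb S) auto
  with insert show ?case by simp
qed (simp add: H10_0[OF S])

section \<open>Poincare inequality and mean of the gradient\<close>

text \<open>
  Integration by parts against the coordinate \<open>x\<^sub>i\<close> gives \<open>\<integral>\<phi>\<^sup>2 = - \<integral>2 x\<^sub>i \<phi> \<partial>\<^sub>i\<phi>\<close>, and half of the left-hand side absorbs
  the factor \<open>\<phi>\<close> on the right by Young's inequality.
\<close>

lemma poincare_test_function:
  assumes S: "open S" "bounded S" and R: "\<And>x. x \<in> S \<Longrightarrow> norm x \<le> R" and \<phi>: "\<phi> \<in> test_functions S"
  shows "(LINT x|lebesgue_on S. (\<phi> x)\<^sup>2) \<le> 4 * R\<^sup>2 * (LINT x|lebesgue_on S. (norm (grad \<phi> x))\<^sup>2)"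
proof -
  \<comment> \<open>The estimate holds with the derivative in any single coordinate direction.\<close>
  fix i :: 'a
  have SL: "S \<in> sets lebesgue" using S by auto
  have \<phi>1: "Ck (Suc 0) \<phi>" using \<phi> test_functions_Ck by blast
  note L = test_function_L2[OF \<phi> S(1)] grad_L2[OF S \<phi>1]
  have i: "integrable (lebesgue_on S) (\<lambda>x. (\<phi> x)\<^sup>2)" "integrable (lebesgue_on S) (\<lambda>x. (norm (grad \<phi> x))\<^sup>2)"
    using L by (auto simp: L2_iff[OF SL])
  have "pd i (\<lambda>x. x $ i) = (\<lambda>x. 1)"
    using pd_affine[of i "axis i 1" 0] by (simp add: inner_axis')
  moreover have "(\<lambda>x. \<phi> x * \<phi> x) \<in> test_functions S"
    using \<phi> by (intro test_functions_Ck_mult test_functions_Ck)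
  ultimately have "(LINT x|lebesgue_on S. x $ i * pd i (\<lambda>x. \<phi> x * \<phi> x) x) = - (LINT x|lebesgue_on S. \<phi> x * \<phi> x)"
    using is_weak_grad_C1[OF S Ck_coord, of i] by (simp add: is_weak_grad_iff[OF SL] grad_def)
  moreover have "pd i (\<lambda>x. \<phi> x * \<phi> x) x = 2 * \<phi> x * pd i \<phi> x" for x
    using pd_mult[of \<phi> x \<phi> i] \<phi>1 by simp
  ultimately have "(LINT x|lebesgue_on S. (\<phi> x)\<^sup>2) = - (LINT x|lebesgue_on S. x $ i * (2 * \<phi> x * pd i \<phi> x))"
    by (simp add: power2_eq_square)
  also have "\<dots> \<le> \<bar>LINT x|lebesgue_on S. x $ i * (2 * \<phi> x * pd i \<phi> x)\<bar>"
    by simp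
  also have "\<dots> \<le> (LINT x|lebesgue_on S. (\<phi> x)\<^sup>2 / 2 + 2 * R\<^sup>2 * (norm (grad \<phi> x))\<^sup>2)"
  proof (rule order_trans[OF integral_abs_bound integral_mono'])
    show "integrable (lebesgue_on S) (\<lambda>x. (\<phi> x)\<^sup>2 / 2 + 2 * R\<^sup>2 * (norm (grad \<phi> x))\<^sup>2)"
      using i by auto
    fix x assume "x \<in> space (lebesgue_on S)"
    then have x: "\<bar>x $ i\<bar> \<le> R"
      using R[of x] component_le_norm_cart[of x i] by auto
    have "\<bar>pd i \<phi> x\<bar> \<le> norm (grad \<phi> x)"
      using component_le_norm_cart[of "grad \<phi> x" i] by (simp add: grad_def)
    with x have "\<bar>x $ i * pd i \<phi> x\<bar> \<le> R * norm (grad \<phi> x)"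
      unfolding abs_mult by (intro mult_mono) auto
    then have "(x $ i * pd i \<phi> x)\<^sup>2 \<le> (R * norm (grad \<phi> x))\<^sup>2"
      by (metis abs_ge_zero power2_abs power_mono)
    moreover have "\<bar>2 * \<phi> x * (x $ i * pd i \<phi> x)\<bar> \<le> (\<phi> x)\<^sup>2 / 2 + 2 * (x $ i * pd i \<phi> x)\<^sup>2"
    proof -
      have "\<bar>2 * a * b\<bar> \<le> a\<^sup>2 / 2 + 2 * b\<^sup>2" for a b :: real
        using zero_le_power2[of "a + 2 * b"] zero_le_power2[of "a - 2 * b"]
        by (simp add: power2_eq_square algebra_simps abs_le_iff)
      then show ?thesis .
    qed
    ultimately show "\<bar>x $ i * (2 * \<phi> x * pd i \<phi> x)\<bar> \<le> (\<phi> x)\<^sup>2 / 2 + 2 * R\<^sup>2 * (norm (grad \<phi> x))\<^sup>2"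
      by (simp add: power_mult_distrib algebra_simps)
  qed simp
  also have "\<dots> = (LINT x|lebesgue_on S. (\<phi> x)\<^sup>2) / 2 + 2 * R\<^sup>2 * (LINT x|lebesgue_on S. (norm (grad \<phi> x))\<^sup>2)"
    using i by simp
  finally show ?thesis by simp
qed

text \<open>
  If the gradient vanishes, the gradients of the approximating test functions tend to zero, and the Poincare
  inequality for these carries over to the limit.
\<close>

lemma H10_AE_zero_if_grad_zero:
  assumes S: "open S" "bounded S" and d: "d \<in> H10 S" and g: "is_weak_grad S d g"
    and g0: "AE x in lebesgue_on S. g x = 0"
  shows "AE x in lebesgue_on S. d x = 0"
proof -
  have SL: "S \<in> sets lebesgue" using S by auto
  obtain R where R: "\<And>x. x \<in> S \<Longrightarrow> norm x \<le> R" using S(2) by (auto simp: bounded_iff)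
  obtain \<phi> where \<phi>: "approximates_in_H1 S \<phi> d g" using H10E[OF S d g] .
  then have t: "\<phi> k \<in> test_functions S" for k by (simp add: approximates_in_H1_def)
  have gL: "g \<in> L2 S" using g by (simp add: is_weak_grad_def)
  let ?a = "\<lambda>k. LINT x|lebesgue_on S. (d x - \<phi> k x)\<^sup>2"
  let ?b = "\<lambda>k. LINT x|lebesgue_on S. (norm (g x - grad (\<phi> k) x))\<^sup>2"
  have "(LINT x|lebesgue_on S. (d x)\<^sup>2) \<le> 2 * ?a k + 8 * R\<^sup>2 * ?b k" for k
  proof -
    note L = test_function_L2(1)[OF t[of k] S(1)] grad_L2(2)[OF S test_functions_Ck[OF t[of k]]]
    note L' = L2_diff[OF SL H10D(1)[OF d] L(1)] L2_diff[OF SL gL L(2)]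
    have "(LINT x|lebesgue_on S. (d x)\<^sup>2) \<le> (LINT x|lebesgue_on S. 2 * (d x - \<phi> k x)\<^sup>2 + 2 * (\<phi> k x)\<^sup>2)"
    proof (rule integral_mono)
      show "(d x)\<^sup>2 \<le> 2 * (d x - \<phi> k x)\<^sup>2 + 2 * (\<phi> k x)\<^sup>2" for x
        using norm_add_sq_le[of "d x - \<phi> k x" "\<phi> k x"] by simp
    qed (use L L' H10D(1)[OF d] in \<open>auto simp: L2_iff[OF SL]\<close>)
    also have "\<dots> = 2 * ?a k + 2 * (LINT x|lebesgue_on S. (\<phi> k x)\<^sup>2)"
      using L L' by (simp add: L2_iff[OF SL])
    also have "(LINT x|lebesgue_on S. (\<phi> k x)\<^sup>2) \<le> 4 * R\<^sup>2 * (LINT x|lebesgue_on S. (norm (grad (\<phi> k) x))\<^sup>2)"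
      by (rule poincare_test_function[OF S R t])
    also have "(LINT x|lebesgue_on S. (norm (grad (\<phi> k) x))\<^sup>2) = ?b k"
    proof (rule integral_cong_AE)
      show "AE x in lebesgue_on S. (norm (grad (\<phi> k) x))\<^sup>2 = (norm (g x - grad (\<phi> k) x))\<^sup>2"
        using g0 by eventually_elim simp
    qed (use L L' in \<open>auto simp: L2_iff[OF SL]\<close>)
    finally show ?thesis by simp
  qed
  moreover have "(\<lambda>k. 2 * ?a k + 8 * R\<^sup>2 * ?b k) \<longlonglongrightarrow> 2 * 0 + 8 * R\<^sup>2 * 0"
    using \<phi> unfolding approximates_in_H1_def by (intro tendsto_intros) auto
  ultimately have "(LINT x|lebesgue_on S. (d x)\<^sup>2) \<le> 2 * 0 + 8 * R\<^sup>2 * 0"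
    by (intro LIMSEQ_le_const) auto
  moreover have "0 \<le> (LINT x|lebesgue_on S. (d x)\<^sup>2)" by simp
  ultimately have "(LINT x|lebesgue_on S. (d x)\<^sup>2) = 0" by linarith
  then have "AE x in lebesgue_on S. (d x)\<^sup>2 = 0"
    using integral_nonneg_eq_0_iff_AE[of "lebesgue_on S" "\<lambda>x. (d x)\<^sup>2"] H10D(1)[OF d] by (simp add: L2_iff[OF SL])
  then show ?thesis by simp
qed

text \<open>
  The statement holds for test functions by integration by parts against the constant \<open>1\<close> and is stable under
  convergence of gradients in \<open>L\<^sup>2\<close>, since \<open>S\<close> has finite measure. The pointwise inequality \<open>t \<le> \<epsilon> + t\<^sup>2 / \<epsilon>\<close>
  replaces the Cauchy-Schwarz inequality.
\<close>

lemma H10_mean_grad_zero: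
  assumes S: "open S" "bounded S" and d: "d \<in> H10 S" and g: "is_weak_grad S d g"
  shows "(LINT x|lebesgue_on S. g x $ i) = 0"
proof -
  have SL: "S \<in> sets lebesgue" "S \<in> lmeasurable" using S by (auto intro: bounded_set_imp_lmeasurable)
  interpret finite_measure "lebesgue_on S" using SL(2) by (rule finite_measure_lebesgue_on)
  obtain \<phi> where \<phi>: "approximates_in_H1 S \<phi> d g" using H10E[OF S d g] .
  then have t: "\<phi> k \<in> test_functions S" for k by (simp add: approximates_in_H1_def)
  have gL: "g \<in> L2 S" using g by (simp add: is_weak_grad_def)
  let ?b = "\<lambda>k. LINT x|lebesgue_on S. (norm (g x - grad (\<phi> k) x))\<^sup>2"
  let ?V = "LINT x|lebesgue_on S. (1::real)"
  have le: "\<bar>LINT x|lebesgue_on S. g x $ i\<bar> \<le> \<epsilon> * ?V + ?b k / \<epsilon>" if \<epsilon>: "0 < \<epsilon>" for \<epsilon> k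
  proof -
    note L = grad_L2(2)[OF S test_functions_Ck[OF t[of k]]]
    have "(LINT x|lebesgue_on S. 1 * pd i (\<phi> k) x) = 0"
      using is_weak_grad_C1[OF S Ck_const, of 1] t[of k] by (simp add: is_weak_grad_iff[OF SL(1)] grad_def pd_const)
    then have "(LINT x|lebesgue_on S. g x $ i) = (LINT x|lebesgue_on S. (g x - grad (\<phi> k) x) $ i)"
      using L2_integrable[OF SL(2) L2_nth[OF SL(1) gL, of i]] L2_integrable[OF SL(2) L2_nth[OF SL(1) L, of i]]
      by (simp add: grad_def)
    also have "\<bar>\<dots>\<bar> \<le> (LINT x|lebesgue_on S. \<epsilon> * 1 + (norm (g x - grad (\<phi> k) x))\<^sup>2 / \<epsilon>)"
    proof (rule order_trans[OF integral_abs_bound integral_mono'])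
      show "integrable (lebesgue_on S) (\<lambda>x. \<epsilon> * 1 + (norm (g x - grad (\<phi> k) x))\<^sup>2 / \<epsilon>)"
        using L2_diff[OF SL(1) gL L] by (auto simp: L2_iff[OF SL(1)])
      fix x
      have "t \<le> \<epsilon> * 1 + t\<^sup>2 / \<epsilon>" if "0 \<le> t" for t :: real
      proof (cases "t \<le> \<epsilon>")
        case True
        moreover have "0 \<le> t\<^sup>2 / \<epsilon>" using \<epsilon> by simp
        ultimately show ?thesis by linarith
      next
        case False
        then have "t \<le> t\<^sup>2 / \<epsilon>" using \<epsilon> that by (simp add: field_simps power2_eq_square mult_left_mono)
        with \<epsilon> show ?thesis by linarith
      qed
      from this[of "norm (g x - grad (\<phi> k) x)"]
      show "\<bar>(g x - grad (\<phi> k) x) $ i\<bar> \<le> \<epsilon> * 1 + (norm (g x - grad (\<phi> k) x))\<^sup>2 / \<epsilon>"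
        using component_le_norm_cart[of "g x - grad (\<phi> k) x" i] by simp
    qed (use \<epsilon> in simp)
    also have "\<dots> = \<epsilon> * ?V + ?b k / \<epsilon>"
      using L2_diff[OF SL(1) gL L] by (simp add: L2_iff[OF SL(1)])
    finally show ?thesis .
  qed
  have lim: "(\<lambda>k. \<epsilon> * ?V + ?b k / \<epsilon>) \<longlonglongrightarrow> \<epsilon> * ?V + 0 / \<epsilon>" if "0 < \<epsilon>" for \<epsilon>
    using \<phi> that unfolding approximates_in_H1_def by (intro tendsto_intros) auto
  have le': "\<bar>LINT x|lebesgue_on S. g x $ i\<bar> \<le> \<epsilon> * ?V" if "0 < \<epsilon>" for \<epsilon>
    using LIMSEQ_le_const[OF lim[OF that], of "\<bar>LINT x|lebesgue_on S. g x $ i\<bar>"] le[OF that] by simp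
  have "\<bar>LINT x|lebesgue_on S. g x $ i\<bar> \<le> 0"
  proof (rule field_le_epsilon)
    fix e :: real assume "0 < e"
    have V: "0 \<le> ?V" by simp
    then have "0 < ?V + 1" by linarith
    then have 1: "\<bar>LINT x|lebesgue_on S. g x $ i\<bar> \<le> e / (?V + 1) * ?V"
      using \<open>0 < e\<close> by (intro le' divide_pos_pos)
    have "e / (t + 1) * t \<le> e" if "0 \<le> t" for t
      using that \<open>0 < e\<close> by (simp add: field_simps)
    from this[OF V] have "e / (?V + 1) * ?V \<le> e" .
    with 1 show "\<bar>LINT x|lebesgue_on S. g x $ i\<bar> \<le> 0 + e" by linarith
  qed
  then show ?thesis by simp
qed

section \<open>Bilinearity of the forms\<close>

lemma H1I: "u \<in> L2 S \<Longrightarrow> is_weak_grad S u g \<Longrightarrow> u \<in> H1 S"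
  by (auto simp: H1_def)

lemma H1_L2: "u \<in> H1 S \<Longrightarrow> u \<in> L2 S"
  by (simp add: H1_def)

lemma H10_H1: "u \<in> H10 S \<Longrightarrow> u \<in> H1 S"
  by (simp add: H10_def)

lemma H1_Ck: "open S \<Longrightarrow> bounded S \<Longrightarrow> Ck (Suc 0) u \<Longrightarrow> u \<in> H1 S"
  using is_weak_grad_C1 grad_L2 by (blast intro: H1I)

lemma H1_mono:
  assumes "open U" "open S" "U \<subseteq> S" "u \<in> H1 S"
  shows "u \<in> H1 U"
  using assms is_weak_grad_mono[OF assms(1-3) wgrad_is_weak_grad[OF assms(4)]] L2_mono[OF assms(3) _ _ H1_L2]
  by (intro H1I) auto

lemma H1_lincomb:
  assumes S: "open S" "bounded S" and u: "u \<in> H1 S" and v: "v \<in> H1 S"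
  shows "(\<lambda>x. a * u x + b * v x) \<in> H1 S"
proof -
  have SL: "S \<in> sets lebesgue" using S by auto
  show ?thesis
    using is_weak_grad_lincomb[OF S(1) H1_L2[OF u] wgrad_is_weak_grad[OF u] H1_L2[OF v] wgrad_is_weak_grad[OF v]]
      L2_add[OF SL L2_scaleR[OF SL H1_L2[OF u]] L2_scaleR[OF SL H1_L2[OF v]]]
    by (intro H1I) auto
qed

lemma H1_sum:
  assumes S: "open S" "bounded S" and "finite I" "\<And>i. i \<in> I \<Longrightarrow> u i \<in> H1 S"
  shows "(\<lambda>x. \<Sum>i\<in>I. c i * u i x) \<in> H1 S"
  using assms(3,4)
proof (induction I rule: finite_induct)
  case (insert j I)
  then have "(\<lambda>x. c j * u j x + 1 * (\<Sum>i\<in>I. c i * u i x)) \<in> H1 S"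
    by (intro H1_lincomb S) auto
  with insert show ?case by simp
qed (simp add: H1_Ck[OF S Ck_const])

lemma bform_lincomb_left:
  assumes S: "open S" "bounded S" and B: "B \<in> Linfty S" and H: "u \<in> H1 S" "v \<in> H1 S" "z \<in> H1 S"
  shows "bform S B (\<lambda>x. a * u x + b * v x) z = a * bform S B u z + b * bform S B v z"
proof -
  note W = H[THEN wgrad_is_weak_grad]
  have SL: "S \<in> sets lebesgue" using S by auto
  have "wgrad S u \<in> L2 S" "wgrad S v \<in> L2 S" "wgrad S z \<in> L2 S" using W by (auto simp: is_weak_grad_def)
  note I = form_integrable[OF SL B this(1,3)] form_integrable[OF SL B this(2,3)]
  show ?thesis
    using I bform_eq[OF S B is_weak_grad_lincomb[OF S(1) H1_L2[OF H(1)] W(1) H1_L2[OF H(2)] W(2)] W(3), of a b]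
    by (simp add: bform_eq[OF S B W(1) W(3)] bform_eq[OF S B W(2) W(3)] matrix_vector_right_distrib
        matrix_vector_mult_scaleR inner_add_right)
qed

lemma bform_lincomb_right:
  assumes S: "open S" "bounded S" and B: "B \<in> Linfty S" and H: "u \<in> H1 S" "v \<in> H1 S" "z \<in> H1 S"
  shows "bform S B z (\<lambda>x. a * u x + b * v x) = a * bform S B z u + b * bform S B z v"
proof -
  note W = H[THEN wgrad_is_weak_grad]
  have SL: "S \<in> sets lebesgue" using S by auto
  have "wgrad S u \<in> L2 S" "wgrad S v \<in> L2 S" "wgrad S z \<in> L2 S" using W by (auto simp: is_weak_grad_def)
  note I = form_integrable[OF SL B this(3,1)] form_integrable[OF SL B this(3,2)]
  show ?thesis
    using I bform_eq[OF S B W(3) is_weak_grad_lincomb[OF S(1) H1_L2[OF H(1)] W(1) H1_L2[OF H(2)] W(2)], of a b]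
    by (simp add: bform_eq[OF S B W(3) W(1)] bform_eq[OF S B W(3) W(2)] inner_add_left)
qed

lemma bform_sum_left:
  assumes S: "open S" "bounded S" and B: "B \<in> Linfty S" and "finite I" "\<And>i. i \<in> I \<Longrightarrow> u i \<in> H1 S"
    and z: "z \<in> H1 S"
  shows "bform S B (\<lambda>x. \<Sum>i\<in>I. c i * u i x) z = (\<Sum>i\<in>I. c i * bform S B (u i) z)"
  using assms(4,5)
proof (induction I rule: finite_induct)
  case empty
  show ?case using bform_lincomb_left[OF S B z z z, of 0 0] by simp
next
  case (insert j I)
  then have "bform S B (\<lambda>x. c j * u j x + 1 * (\<Sum>i\<in>I. c i * u i x)) z
     = c j * bform S B (u j) z + 1 * bform S B (\<lambda>x. \<Sum>i\<in>I. c i * u i x) z"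
    by (intro bform_lincomb_left[OF S B] H1_sum[OF S] z) auto
  with insert show ?case by simp
qed

lemma bform_sum_right:
  assumes S: "open S" "bounded S" and B: "B \<in> Linfty S" and "finite I" "\<And>i. i \<in> I \<Longrightarrow> u i \<in> H1 S"
    and z: "z \<in> H1 S"
  shows "bform S B z (\<lambda>x. \<Sum>i\<in>I. c i * u i x) = (\<Sum>i\<in>I. c i * bform S B z (u i))"
  using assms(4,5)
proof (induction I rule: finite_induct)
  case empty
  show ?case using bform_lincomb_right[OF S B z z z, of 0 0] by simp
next
  case (insert j I)
  then have "bform S B z (\<lambda>x. c j * u j x + 1 * (\<Sum>i\<in>I. c i * u i x))
     = c j * bform S B z (u j) + 1 * bform S B z (\<lambda>x. \<Sum>i\<in>I. c i * u i x)"
    by (intro bform_lincomb_right[OF S B] H1_sum[OF S] z) auto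
  with insert show ?case by simp
qed

lemma bform_eq_0_if_grad_zero:
  assumes S: "open S" "bounded S" and B: "B \<in> Linfty S" and u: "is_weak_grad S u p" and v: "is_weak_grad S v q"
    and p: "(AE x in lebesgue_on S. p x = 0) \<or> (AE x in lebesgue_on S. q x = 0)"
  shows "bform S B u v = 0"
proof -
  have "AE x in lebesgue_on S. q x \<bullet> (B x *v p x) = 0"
    using p
  proof
    assume "AE x in lebesgue_on S. p x = 0"
    then show ?thesis by eventually_elim simp
  next
    assume "AE x in lebesgue_on S. q x = 0"
    then show ?thesis by eventually_elim simp
  qed
  then have "(LINT x|lebesgue_on S. q x \<bullet> (B x *v p x)) = 0" by (rule integral_eq_zero_AE)
  then show ?thesis by (simp only: bform_eq[OF S B u v])
qed

lemma Linfty_mono: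
  assumes "U \<subseteq> S" "U \<in> sets lebesgue" "S \<in> sets lebesgue" and B: "B \<in> Linfty S"
  shows "B \<in> Linfty U"
proof -
  obtain C where "AE x in lebesgue. x \<in> S \<longrightarrow> norm (B x) \<le> C" using B by (auto simp: Linfty_def)
  then have "AE x in lebesgue. x \<in> U \<longrightarrow> norm (B x) \<le> C"
    by eventually_elim (use assms(1) in auto)
  moreover have "set_borel_measurable lebesgue U B"
    by (rule set_borel_measurable_subset[of _ S, OF _ assms(2,1)]) (use B in \<open>simp add: Linfty_def\<close>)
  ultimately show ?thesis by (auto simp: Linfty_def)
qed

section \<open>Positive definite linear systems\<close>

text \<open>
  Gaussian elimination: the pivot \<open>a k k\<close> is positive, and the Schur complement \<open>a'\<close> of the remaining indices is
  again positive definite, because its quadratic form at \<open>c\<close> is that of \<open>a\<close> at the extension of \<open>c\<close> that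
  annihilates row \<open>k\<close>.
\<close>

lemma positive_definite_solvable:
  fixes a :: "'i \<Rightarrow> 'i \<Rightarrow> real"
  assumes "finite I"
    and "\<And>c. (\<exists>i\<in>I. c i \<noteq> 0) \<Longrightarrow> 0 < (\<Sum>j\<in>I. c j * (\<Sum>i\<in>I. a j i * c i))"
  shows "\<exists>c. \<forall>j\<in>I. (\<Sum>i\<in>I. a j i * c i) = b j"
  using assms
proof (induction I arbitrary: a b rule: finite_induct)
  case (insert k I)
  have "0 < (\<Sum>j\<in>insert k I. (if j = k then 1 else 0) * (\<Sum>i\<in>insert k I. a j i * (if i = k then 1 else 0)))"
    by (rule insert.prems) auto
  then have akk: "0 < a k k" using insert.hyps by (simp add: sum.neutral if_distrib cong: if_cong)
  define a' where "a' j i = a j i - a j k * a k i / a k k" for j i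
  \<comment> \<open>The value at k solves equation k with right-hand side \<open>\<beta>\<close>.\<close>
  let ?ext = "\<lambda>\<beta> c i. if i = k then (\<beta> - (\<Sum>i\<in>I. a k i * c i)) / a k k else c i"
  have ext_sum: "(\<Sum>i\<in>insert k I. a j i * ?ext \<beta> c i) = (\<Sum>i\<in>I. a' j i * c i) + a j k * \<beta> / a k k" for j \<beta> c
  proof -
    have "(\<Sum>i\<in>insert k I. a j i * ?ext \<beta> c i) = a j k * ((\<beta> - (\<Sum>i\<in>I. a k i * c i)) / a k k) + (\<Sum>i\<in>I. a j i * c i)"
      using insert.hyps by (auto intro!: sum.cong)
    also have "\<dots> = (\<Sum>i\<in>I. a' j i * c i) + a j k * \<beta> / a k k"
      by (simp add: a'_def left_diff_distrib sum_subtractf sum_distrib_left diff_divide_distrib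
          sum_divide_distrib right_diff_distrib mult.assoc)
    finally show ?thesis .
  qed
  have ext_k: "(\<Sum>i\<in>insert k I. a k i * ?ext \<beta> c i) = \<beta>" for \<beta> c
    using ext_sum[of k \<beta> c] akk by (simp add: a'_def)
  have "0 < (\<Sum>j\<in>I. c j * (\<Sum>i\<in>I. a' j i * c i))" if "\<exists>i\<in>I. c i \<noteq> 0" for c
  proof -
    have "\<exists>i\<in>insert k I. ?ext 0 c i \<noteq> 0" using that insert.hyps by auto
    from insert.prems[OF this]
    have "0 < (\<Sum>j\<in>insert k I. ?ext 0 c j * (\<Sum>i\<in>insert k I. a j i * ?ext 0 c i))" .
    also have "\<dots> = (\<Sum>j\<in>I. ?ext 0 c j * (\<Sum>i\<in>insert k I. a j i * ?ext 0 c i))"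
      using sum.insert[OF insert.hyps, of "\<lambda>j. ?ext 0 c j * (\<Sum>i\<in>insert k I. a j i * ?ext 0 c i)"]
      by (simp only: ext_k mult_zero_right add_0)
    also have "\<dots> = (\<Sum>j\<in>I. c j * (\<Sum>i\<in>I. a' j i * c i))"
      using insert.hyps by (intro sum.cong refl) (simp only: ext_sum, auto)
    finally show ?thesis .
  qed
  from insert.IH[OF this, of "\<lambda>j. b j - a j k * b k / a k k"]
  obtain c where c: "\<forall>j\<in>I. (\<Sum>i\<in>I. a' j i * c i) = b j - a j k * b k / a k k" by blast
  have "\<forall>j\<in>insert k I. (\<Sum>i\<in>insert k I. a j i * ?ext (b k) c i) = b j"
  proof
    fix j assume "j \<in> insert k I"
    then show "(\<Sum>i\<in>insert k I. a j i * ?ext (b k) c i) = b j"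
      by (cases "j = k") (simp only: ext_k, use c in \<open>simp only: ext_sum, auto\<close>)
  qed
  then show ?case by (rule exI[of _ "?ext (b k) c"])
qed simp

section \<open>Geometry of the mesh\<close>

locale msfem =
  fixes \<Omega> :: "(real ^ 'n::finite) set"
    and A :: "real ^ 'n \<Rightarrow> real ^ 'n ^ 'n"
    and m :: real
    and T :: "(real ^ 'n) set set"
    and w :: "(real ^ 'n) set \<Rightarrow> 'n \<Rightarrow> real ^ 'n \<Rightarrow> real"
  assumes open_\<Omega>: "open \<Omega>" and bounded_\<Omega>: "bounded \<Omega>"
    and A_Linfty: "A \<in> Linfty \<Omega>" and m_pos: "0 < m"
    and coercive: "\<forall>\<xi>. AE x in lebesgue. x \<in> \<Omega> \<longrightarrow> m * (norm \<xi>)\<^sup>2 \<le> \<xi> \<bullet> (A x *v \<xi>)"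
    and mesh: "simplicial_mesh \<Omega> T"
    and corr: "\<forall>K\<in>T. \<forall>\<alpha>. corrector K A \<alpha> (w K \<alpha>)"
begin

lemma \<Omega>_lebesgue: "\<Omega> \<in> sets lebesgue"
  using open_\<Omega> by auto

lemma finite_T: "finite T"
  using mesh by (simp add: simplicial_mesh_def triangulation_def)

lemma element_geometry:
  assumes "K \<in> T"
  shows "compact K" "convex K" "interior K \<noteq> {}" "interior K \<subseteq> \<Omega>" "open (interior K)" "bounded (interior K)"
    "interior K \<in> sets lebesgue" "0 < measure lebesgue (interior K)" "measure lebesgue K = measure lebesgue (interior K)"
proof -
  have K: "int CARD('n) simplex K" and "interior K \<subseteq> \<Omega>"
    using mesh assms by (auto simp: simplicial_mesh_def)
  then show c: "compact K" "convex K" "interior K \<subseteq> \<Omega>"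
    by (auto intro: compact_simplex convex_simplex)
  then show b: "open (interior K)" "bounded (interior K)" "interior K \<in> sets lebesgue"
    using bounded_\<Omega> by (auto intro: bounded_subset)
  have "aff_dim K = int CARD('n)" using K by (rule aff_dim_simplex)
  then have "affine hull K = UNIV" by (intro affine_hull_UNIV) simp
  then have "interior K = rel_interior K" by (simp add: rel_interior_interior)
  moreover have "K \<noteq> {}" using K by auto
  ultimately show ne: "interior K \<noteq> {}" using c rel_interior_eq_empty by metis
  have "interior K \<in> lmeasurable" using b by (intro bounded_set_imp_lmeasurable) auto
  with ne show "0 < measure lebesgue (interior K)"
    using open_not_negligible[OF b(1) ne] by (metis measure_eq_0_null_sets negligible_iff_null_sets negligible_iff_measure measure_nonneg less_le)
  show "measure lebesgue K = measure lebesgue (interior K)"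
    using c by (metis closure_closed compact_imp_bounded compact_imp_closed measure_closure measure_interior negligible_convex_frontier)
qed

text \<open>
  The intersection of two elements is a face of both, and a face that meets the interior is the whole simplex.
\<close>

lemma interiors_disjoint:
  assumes "K \<in> T" "K' \<in> T" "x \<in> interior K" "x \<in> interior K'"
  shows "K = K'"
proof -
  have "(K \<inter> K') face_of K" "(K' \<inter> K) face_of K'"
    using mesh assms by (auto simp: simplicial_mesh_def triangulation_def)
  moreover have "x \<in> K \<inter> K'" using assms interior_subset by blast
  ultimately have "K \<inter> K' = K" "K' \<inter> K = K'"
    using assms face_of_disjoint_interior by blast+
  then show ?thesis by blast
qed

text \<open>
  The exceptional points lie on the frontiers of the elements, which are negligible because the elements are
  convex.
\<close>

lemma AE_in_element: "AE x in lebesgue. x \<in> \<Omega> \<longrightarrow> (\<exists>K\<in>T. x \<in> interior K)"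
proof -
  have "negligible (\<Union>K\<in>T. frontier K)"
    using finite_T element_geometry(2) by (intro negligible_Union) (auto intro: negligible_convex_frontier)
  then have "AE x in lebesgue. x \<notin> (\<Union>K\<in>T. frontier K)"
    unfolding negligible_iff_null_sets by (rule AE_not_in)
  then show ?thesis
  proof eventually_elim
    fix x assume x: "x \<notin> (\<Union>K\<in>T. frontier K)"
    have "\<Omega> \<subseteq> \<Union>T" using mesh closure_subset by (auto simp: simplicial_mesh_def)
    show "x \<in> \<Omega> \<longrightarrow> (\<exists>K\<in>T. x \<in> interior K)"
    proof
      assume "x \<in> \<Omega>"
      with \<open>\<Omega> \<subseteq> \<Union>T\<close> obtain K where "K \<in> T" "x \<in> K" by blast
      moreover from this have "x \<notin> frontier K" "x \<in> closure K" using x closure_subset by auto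
      ultimately show "\<exists>K\<in>T. x \<in> interior K" by (auto simp: frontier_def)
    qed
  qed
qed

lemma AE_mesh:
  assumes "\<And>K. K \<in> T \<Longrightarrow> AE x in lebesgue_on (interior K). P x"
  shows "AE x in lebesgue_on \<Omega>. P x"
proof -
  have "AE x in lebesgue. x \<in> interior K \<longrightarrow> P x" if "K \<in> T" for K
    using assms[OF that] element_geometry(7)[OF that] by (simp add: AE_restrict_space_iff)
  then have "AE x in lebesgue. \<forall>K\<in>T. x \<in> interior K \<longrightarrow> P x"
    using finite_T by (subst AE_ball_countable) (auto intro: countable_finite)
  with AE_in_element have "AE x in lebesgue. x \<in> \<Omega> \<longrightarrow> P x"
    by eventually_elim blast
  then show ?thesis using \<Omega>_lebesgue by (simp add: AE_restrict_space_iff)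
qed

lemma AE_restrict_element:
  assumes "K \<in> T" "AE x in lebesgue_on \<Omega>. P x"
  shows "AE x in lebesgue_on (interior K). P x"
proof -
  have "AE x in lebesgue. x \<in> \<Omega> \<longrightarrow> P x" using assms(2) \<Omega>_lebesgue by (simp add: AE_restrict_space_iff)
  then have "AE x in lebesgue. x \<in> interior K \<longrightarrow> P x"
    by eventually_elim (use element_geometry(4)[OF assms(1)] in auto)
  then show ?thesis using element_geometry(7)[OF assms(1)] by (simp add: AE_restrict_space_iff)
qed

lemma sum_indicator_elements:
  assumes "K \<in> T" "x \<in> interior K"
  shows "(\<Sum>K'\<in>T. indicator (interior K') x *\<^sub>R f K') = (f K :: 'b::real_vector)"
proof -
  have "(\<Sum>K'\<in>T. indicator (interior K') x *\<^sub>R f K') = (\<Sum>K'\<in>T. if K' = K then f K else 0)"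
    using assms interiors_disjoint by (intro sum.cong) (auto simp: indicator_def)
  with finite_T assms show ?thesis by simp
qed

lemma integral_mesh:
  fixes h :: "real ^ 'n \<Rightarrow> real"
  assumes h: "integrable (lebesgue_on \<Omega>) h"
  shows "(LINT x|lebesgue_on \<Omega>. h x) = (\<Sum>K\<in>T. LINT x|lebesgue_on (interior K). h x)"
proof -
  have h\<Omega>: "integrable lebesgue (\<lambda>x. indicator \<Omega> x *\<^sub>R h x)"
    using h \<Omega>_lebesgue by (simp add: integrable_restrict_space)
  have hK: "integrable lebesgue (\<lambda>x. indicator (interior K) x *\<^sub>R h x)" if "K \<in> T" for K
  proof -
    have "set_integrable lebesgue (interior K) h"
      by (rule set_integrable_subset[OF _ element_geometry(7)[OF that] element_geometry(4)[OF that]])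
         (use h\<Omega> in \<open>simp add: set_integrable_def\<close>)
    then show ?thesis by (simp add: set_integrable_def)
  qed
  have "(LINT x|lebesgue. indicator \<Omega> x *\<^sub>R h x) = (LINT x|lebesgue. (\<Sum>K\<in>T. indicator (interior K) x *\<^sub>R h x))"
  proof (rule integral_cong_AE)
    show "AE x in lebesgue. indicator \<Omega> x *\<^sub>R h x = (\<Sum>K\<in>T. indicator (interior K) x *\<^sub>R h x)"
      using AE_in_element
    proof eventually_elim
      fix x assume x: "x \<in> \<Omega> \<longrightarrow> (\<exists>K\<in>T. x \<in> interior K)"
      show "indicator \<Omega> x *\<^sub>R h x = (\<Sum>K\<in>T. indicator (interior K) x *\<^sub>R h x)"
      proof (cases "x \<in> \<Omega>")
        case True
        with x obtain K where "K \<in> T" "x \<in> interior K" by blast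
        from sum_indicator_elements[OF this, of "\<lambda>_. h x"] True show ?thesis by simp
      next
        case False
        then have "indicator (interior K) x *\<^sub>R h x = 0" if "K \<in> T" for K
          using element_geometry(4)[OF that] by (auto simp: indicator_def)
        with False show ?thesis by (simp add: sum.neutral)
      qed
    qed
  qed (use h\<Omega> hK in \<open>auto intro: borel_measurable_integrable borel_measurable_sum\<close>)
  also have "\<dots> = (\<Sum>K\<in>T. LINT x|lebesgue. indicator (interior K) x *\<^sub>R h x)"
    using hK by (intro Bochner_Integration.integral_sum)
  also have "\<dots> = (\<Sum>K\<in>T. LINT x|lebesgue_on (interior K). h x)"
    using element_geometry(7) by (intro sum.cong refl) (simp add: integral_restrict_space)
  finally show ?thesis using \<Omega>_lebesgue by (simp add: integral_restrict_space)
qed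

lemma Linfty_element: "K \<in> T \<Longrightarrow> B \<in> Linfty \<Omega> \<Longrightarrow> B \<in> Linfty (interior K)"
  using element_geometry(4,7) \<Omega>_lebesgue by (intro Linfty_mono[of "interior K" \<Omega>])

lemma H1_element: "K \<in> T \<Longrightarrow> u \<in> H1 \<Omega> \<Longrightarrow> u \<in> H1 (interior K)"
  using element_geometry(4,5) open_\<Omega> by (intro H1_mono[of "interior K" \<Omega>])

lemma bform_mesh:
  assumes B: "B \<in> Linfty \<Omega>" and u: "u \<in> H1 \<Omega>" and v: "v \<in> H1 \<Omega>"
  shows "bform \<Omega> B u v = (\<Sum>K\<in>T. bform (interior K) B u v)"
proof -
  note W = wgrad_is_weak_grad[OF u] wgrad_is_weak_grad[OF v]
  have "bform \<Omega> B u v = (LINT x|lebesgue_on \<Omega>. wgrad \<Omega> v x \<bullet> (B x *v wgrad \<Omega> u x))"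
    by (rule bform_eq[OF open_\<Omega> bounded_\<Omega> B W])
  also have "\<dots> = (\<Sum>K\<in>T. LINT x|lebesgue_on (interior K). wgrad \<Omega> v x \<bullet> (B x *v wgrad \<Omega> u x))"
    using W by (intro integral_mesh form_integrable \<Omega>_lebesgue B) (auto simp: is_weak_grad_def)
  also have "\<dots> = (\<Sum>K\<in>T. bform (interior K) B u v)"
    using element_geometry(4,5,6) open_\<Omega> B
    by (intro sum.cong refl bform_eq[symmetric] Linfty_element is_weak_grad_mono[OF _ _ _ W(1)] is_weak_grad_mono[OF _ _ _ W(2)]) auto
  finally show ?thesis .
qed

lemma eff_field_element: "K \<in> T \<Longrightarrow> x \<in> interior K \<Longrightarrow> eff_field T A w x = eff_matrix A w K"
  unfolding eff_field_def by (rule sum_indicator_elements)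

lemma eff_field_Linfty: "eff_field T A w \<in> Linfty \<Omega>"
proof -
  have "eff_field T A w \<in> borel_measurable lebesgue"
    unfolding eff_field_def using element_geometry(7) by (intro borel_measurable_sum borel_measurable_scaleR borel_measurable_indicator) auto
  moreover have "norm (eff_field T A w x) \<le> (\<Sum>K\<in>T. norm (eff_matrix A w K))" for x
    unfolding eff_field_def
    by (rule order_trans[OF norm_sum sum_mono]) (auto simp: indicator_def)
  ultimately show ?thesis
    using \<Omega>_lebesgue unfolding Linfty_def set_borel_measurable_def
    by (auto intro!: borel_measurable_scaleR borel_measurable_indicator exI[of _ "\<Sum>K\<in>T. norm (eff_matrix A w K)"])
qed

section \<open>Piecewise affine functions\<close>

text \<open>
  The vector is unique since an element has interior points.
\<close>

definition slope :: "(real ^ 'n \<Rightarrow> real) \<Rightarrow> (real ^ 'n) set \<Rightarrow> real ^ 'n" where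
  "slope u K = (SOME g. \<exists>c. \<forall>x\<in>K. u x = g \<bullet> x + c)"

lemma VH_affine:
  assumes "u \<in> VH \<Omega> T" "K \<in> T"
  shows "\<exists>c. \<forall>x\<in>K. u x = slope u K \<bullet> x + c"
proof -
  have "\<exists>g. \<exists>c. \<forall>x\<in>K. u x = g \<bullet> x + c" using assms by (auto simp: VH_def)
  from someI_ex[OF this] show ?thesis unfolding slope_def .
qed

lemma VH_H10: "u \<in> VH \<Omega> T \<Longrightarrow> u \<in> H10 \<Omega>"
  by (simp add: VH_def)

lemma VH_H1: "u \<in> VH \<Omega> T \<Longrightarrow> u \<in> H1 \<Omega>"
  using VH_H10 H10_H1 by blast

lemma grad_affine: "grad (\<lambda>x. g \<bullet> x + c) = (\<lambda>x. g)"
  by (auto simp: grad_def pd_affine vec_eq_iff fun_eq_iff)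

lemma VH_weak_grad:
  assumes u: "u \<in> VH \<Omega> T" and K: "K \<in> T"
  shows "is_weak_grad (interior K) u (\<lambda>x. slope u K)"
proof -
  obtain c where c: "\<And>x. x \<in> K \<Longrightarrow> u x = slope u K \<bullet> x + c" using VH_affine[OF u K] by blast
  have "is_weak_grad (interior K) (\<lambda>x. slope u K \<bullet> x + c) (\<lambda>x. slope u K)"
    using is_weak_grad_C1[OF element_geometry(5,6)[OF K] Ck_affine, of "slope u K" c] by (simp only: grad_affine)
  then show ?thesis
    by (rule is_weak_grad_cong) (metis c interior_subset subsetD)
qed

lemma VH_pd:
  assumes u: "u \<in> VH \<Omega> T" and K: "K \<in> T" and x: "x \<in> interior K"
  shows "pd \<alpha> u x = slope u K $ \<alpha>"
proof -
  obtain c where c: "\<And>x. x \<in> K \<Longrightarrow> u x = slope u K \<bullet> x + c" using VH_affine[OF u K] by blast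
  have "(u has_derivative (\<lambda>h. slope u K \<bullet> h)) (at x)"
    by (rule has_derivative_transform_within_open[OF has_derivative_affine[of _ c] element_geometry(5)[OF K] x])
       (metis c interior_subset subsetD)
  from pd_eqI[OF this] show ?thesis by (simp add: inner_axis)
qed

lemma VH_lincomb:
  assumes "u \<in> VH \<Omega> T" "v \<in> VH \<Omega> T"
  shows "(\<lambda>x. a * u x + b * v x) \<in> VH \<Omega> T"
proof -
  have "\<exists>g c. \<forall>x\<in>K. a * u x + b * v x = g \<bullet> x + c" if K: "K \<in> T" for K
  proof -
    obtain c where c: "\<And>x. x \<in> K \<Longrightarrow> u x = slope u K \<bullet> x + c" using VH_affine[OF assms(1) K] by blast
    obtain d where d: "\<And>x. x \<in> K \<Longrightarrow> v x = slope v K \<bullet> x + d" using VH_affine[OF assms(2) K] by blast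
    have "a * u x + b * v x = (a *\<^sub>R slope u K + b *\<^sub>R slope v K) \<bullet> x + (a * c + b * d)" if "x \<in> K" for x
      using c[OF that] d[OF that] by (simp add: inner_add_left algebra_simps)
    then show ?thesis by blast
  qed
  then show ?thesis
    using assms H10_lincomb[OF open_\<Omega> bounded_\<Omega>] by (auto simp: VH_def intro!: continuous_intros)
qed

lemma VH_0: "(\<lambda>x. 0) \<in> VH \<Omega> T"
  unfolding VH_def using H10_0[OF open_\<Omega> bounded_\<Omega>]
  by (auto intro!: exI[of _ "0 :: real ^ 'n"] exI[of _ "0 :: real"])

lemma VH_sum:
  assumes "finite I" "\<And>i. i \<in> I \<Longrightarrow> u i \<in> VH \<Omega> T"
  shows "(\<lambda>x. \<Sum>i\<in>I. c i * u i x) \<in> VH \<Omega> T"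
  using assms
proof (induction I rule: finite_induct)
  case (insert j I)
  then have "(\<lambda>x. c j * u j x + 1 * (\<Sum>i\<in>I. c i * u i x)) \<in> VH \<Omega> T"
    by (intro VH_lincomb) auto
  with insert show ?case by simp
qed (simp add: VH_0)

text \<open>
  Being constant on each element, \<open>u\<close> would have to be followed through neighbouring elements to the boundary; the
  Poincare inequality gives \<open>u = 0\<close> almost everywhere at once, and continuity does the rest.
\<close>

lemma VH_eq_0_if_slopes_zero:
  assumes u: "u \<in> VH \<Omega> T" and s: "\<And>K. K \<in> T \<Longrightarrow> slope u K = 0"
  shows "u x = 0"
proof -
  have "AE x in lebesgue_on \<Omega>. wgrad \<Omega> u x = 0"
  proof (rule AE_mesh)
    fix K assume K: "K \<in> T"
    have "is_weak_grad (interior K) u (wgrad \<Omega> u)"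
      using H10D(2)[OF VH_H10[OF u]] element_geometry(4,5)[OF K] open_\<Omega> is_weak_grad_mono by blast
    from is_weak_grad_unique[OF element_geometry(5,6)[OF K] this VH_weak_grad[OF u K]]
    show "AE x in lebesgue_on (interior K). wgrad \<Omega> u x = 0" by (simp add: s[OF K])
  qed
  then have "AE x in lebesgue_on \<Omega>. u x = 0"
    by (rule H10_AE_zero_if_grad_zero[OF open_\<Omega> bounded_\<Omega> VH_H10[OF u] H10D(2)[OF VH_H10[OF u]]])
  then have ae: "AE x in lebesgue. x \<in> \<Omega> \<longrightarrow> u x = 0"
    using \<Omega>_lebesgue by (simp add: AE_restrict_space_iff)
  have "continuous_on \<Omega> u"
    using u closure_subset by (auto simp: VH_def intro: continuous_on_subset)
  then have "open (\<Omega> \<inter> u -` (- {0}))"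
    using open_\<Omega> by (intro continuous_open_preimage) auto
  moreover have "negligible (\<Omega> \<inter> u -` (- {0}))"
  proof -
    have "AE x in lebesgue. x \<notin> \<Omega> \<inter> u -` (- {0})" using ae by eventually_elim auto
    then show ?thesis
      using \<open>open (\<Omega> \<inter> u -` (- {0}))\<close> by (simp add: negligible_iff_null_sets AE_iff_null_sets)
  qed
  ultimately have "\<Omega> \<inter> u -` (- {0}) = {}" using open_not_negligible by blast
  then have "x \<in> \<Omega> \<Longrightarrow> u x = 0" by auto
  moreover have "x \<notin> \<Omega> \<Longrightarrow> u x = 0" using u by (simp add: VH_def)
  ultimately show ?thesis by blast
qed

text \<open>
  An element is the convex hull of its vertices, and a vertex is either an interior vertex of the mesh or lies on the
  frontier of \<open>\<Omega>\<close>, where the function vanishes anyway.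
\<close>

lemma VH_eq_0_if_vertices_zero:
  assumes u: "u \<in> VH \<Omega> T" and v: "\<And>y. y \<in> interior_vertices \<Omega> T \<Longrightarrow> u y = 0"
  shows "u x = 0"
proof (cases "x \<in> \<Omega>")
  case False
  then show ?thesis using u by (simp add: VH_def)
next
  case True
  moreover have "\<Omega> \<subseteq> \<Union>T" using mesh closure_subset by (auto simp: simplicial_mesh_def)
  ultimately obtain K where K: "K \<in> T" "x \<in> K" by blast
  obtain c where c: "\<And>x. x \<in> K \<Longrightarrow> u x = slope u K \<bullet> x + c" using VH_affine[OF u K(1)] by blast
  have "u y = 0" if y: "y extreme_point_of K" for y
  proof (cases "y \<in> frontier \<Omega>")
    case True
    then have "y \<notin> \<Omega>" using open_\<Omega> by (auto simp: frontier_def interior_open)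
    then show ?thesis using u by (simp add: VH_def)
  next
    case False
    then show ?thesis using y K by (intro v) (auto simp: interior_vertices_def)
  qed
  then have "{y. y extreme_point_of K} \<subseteq> {y. slope u K \<bullet> y = - c}"
    using c by (fastforce simp: extreme_point_of_def)
  then have "convex hull {y. y extreme_point_of K} \<subseteq> {y. slope u K \<bullet> y = - c}"
    by (rule hull_minimal) (rule convex_hyperplane)
  with Krein_Milman_Minkowski[OF element_geometry(1,2)[OF K(1)]] K(2) c[OF K(2)] show ?thesis by auto
qed

section \<open>Pairs of a piecewise affine and a multiscale function\<close>

text \<open>
  Working with pairs instead of basis functions makes every identity below available for all linear combinations at
  once.
\<close>

definition ms_pair :: "(real ^ 'n \<Rightarrow> real) \<Rightarrow> (real ^ 'n \<Rightarrow> real) \<Rightarrow> bool" where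
  "ms_pair u u\<epsilon> \<longleftrightarrow> u \<in> VH \<Omega> T \<and> ms_basis_function \<Omega> T A u u\<epsilon>"

lemma ms_pairD:
  assumes "ms_pair u u\<epsilon>"
  shows "u \<in> VH \<Omega> T" "u \<in> H1 \<Omega>" "u\<epsilon> \<in> H10 \<Omega>" "u\<epsilon> \<in> H1 \<Omega>"
    "\<And>K v. K \<in> T \<Longrightarrow> v \<in> H10 (interior K) \<Longrightarrow> bform (interior K) A u\<epsilon> v = 0"
    "\<And>K. K \<in> T \<Longrightarrow> (\<lambda>x. u\<epsilon> x - u x) \<in> H10 (interior K)"
  using assms by (auto simp: ms_pair_def ms_basis_function_def intro: VH_H1 H10_H1)

lemma ms_pair_sum:
  assumes "finite I" and p: "\<And>i. i \<in> I \<Longrightarrow> ms_pair (u i) (u\<epsilon> i)"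
  shows "ms_pair (\<lambda>x. \<Sum>i\<in>I. c i * u i x) (\<lambda>x. \<Sum>i\<in>I. c i * u\<epsilon> i x)"
  unfolding ms_pair_def ms_basis_function_def
proof (intro conjI ballI)
  show "(\<lambda>x. \<Sum>i\<in>I. c i * u i x) \<in> VH \<Omega> T" by (intro VH_sum assms(1) ms_pairD(1)[OF p])
  show "(\<lambda>x. \<Sum>i\<in>I. c i * u\<epsilon> i x) \<in> H10 \<Omega>"
    by (intro H10_sum open_\<Omega> bounded_\<Omega> assms(1) ms_pairD(3)[OF p])
  fix K assume K: "K \<in> T"
  show "bform (interior K) A (\<lambda>x. \<Sum>i\<in>I. c i * u\<epsilon> i x) v = 0" if v: "v \<in> H10 (interior K)" for v
  proof -
    have "bform (interior K) A (\<lambda>x. \<Sum>i\<in>I. c i * u\<epsilon> i x) v = (\<Sum>i\<in>I. c i * bform (interior K) A (u\<epsilon> i) v)"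
      by (intro bform_sum_left element_geometry(5,6)[OF K] Linfty_element K A_Linfty H1_element H10_H1[OF v] assms(1) ms_pairD(4)[OF p])
    also have "\<dots> = 0" using ms_pairD(5)[OF p K v] by simp
    finally show ?thesis .
  qed
  have "(\<lambda>x. \<Sum>i\<in>I. c i * (u\<epsilon> i x - u i x)) \<in> H10 (interior K)"
    by (intro H10_sum element_geometry(5,6)[OF K] assms(1) ms_pairD(6)[OF p K])
  then show "(\<lambda>x. (\<Sum>i\<in>I. c i * u\<epsilon> i x) - (\<Sum>i\<in>I. c i * u i x)) \<in> H10 (interior K)"
    by (simp add: right_diff_distrib sum_subtractf)
qed

text \<open>
  The locally \<open>A\<close>-harmonic function with the boundary values of the coordinate \<open>x\<^sub>\<alpha>\<close>.
\<close>

definition cell :: "(real ^ 'n) set \<Rightarrow> 'n \<Rightarrow> real ^ 'n \<Rightarrow> real" where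
  "cell K \<alpha> x = x $ \<alpha> + w K \<alpha> x"

lemma corrD:
  assumes "K \<in> T"
  shows "w K \<alpha> \<in> H10 (interior K)"
    "v \<in> H10 (interior K) \<Longrightarrow> bform (interior K) A (w K \<alpha>) v =
        - (LINT x:interior K|lebesgue. wgrad (interior K) v x \<bullet> (A x *v axis \<alpha> 1))"
  using corr assms by (auto simp: corrector_def)

lemma coord_weak_grad: "K \<in> T \<Longrightarrow> is_weak_grad (interior K) (\<lambda>x. x $ \<alpha>) (\<lambda>x. axis \<alpha> 1)"
  using is_weak_grad_C1[OF element_geometry(5,6) Ck_affine, of K "axis \<alpha> 1" 0]
    grad_affine[of "axis \<alpha> 1" 0] by (simp add: inner_axis')

lemma coord_H1: "K \<in> T \<Longrightarrow> (\<lambda>x. x $ \<alpha>) \<in> H1 (interior K)"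
  by (intro H1_Ck element_geometry Ck_coord)

lemma cell_H1: "K \<in> T \<Longrightarrow> cell K \<alpha> \<in> H1 (interior K)"
  using H1_lincomb[OF element_geometry(5,6) coord_H1[of K \<alpha>] H10_H1[OF corrD(1)[of K \<alpha>]], where a=1 and b=1]
  by (simp add: cell_def[abs_def])

text \<open>
  This is the equation of the corrector, rewritten with the gradient \<open>e\<^sub>\<alpha>\<close> of the coordinate.
\<close>

lemma bform_cell_H10:
  assumes K: "K \<in> T" and v: "v \<in> H10 (interior K)"
  shows "bform (interior K) A (cell K \<alpha>) v = 0"
proof -
  note E = element_geometry(5,6)[OF K] Linfty_element[OF K A_Linfty]
  have "bform (interior K) A (cell K \<alpha>) v = bform (interior K) A (\<lambda>x. x $ \<alpha>) v + bform (interior K) A (w K \<alpha>) v"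
    using bform_lincomb_left[OF E coord_H1[OF K, of \<alpha>] H10_H1[OF corrD(1)[OF K, of \<alpha>]] H10_H1[OF v], where a=1 and b=1]
    by (simp add: cell_def[abs_def])
  also have "bform (interior K) A (\<lambda>x. x $ \<alpha>) v = (LINT x|lebesgue_on (interior K). wgrad (interior K) v x \<bullet> (A x *v axis \<alpha> 1))"
    by (rule bform_eq[OF E coord_weak_grad[OF K] H10D(2)[OF v]])
  also have "bform (interior K) A (w K \<alpha>) v = - (LINT x|lebesgue_on (interior K). wgrad (interior K) v x \<bullet> (A x *v axis \<alpha> 1))"
    using corrD(2)[OF K v] set_lebesgue_integral_eq_lebesgue_on[OF element_geometry(7)[OF K]] by simp
  finally show ?thesis by simp
qed

text \<open>
  The first order reconstruction of \<open>u\<close> on \<open>K\<close>, up to the additive constant by which \<open>u\<close> differs from its linear part.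
\<close>

definition corrected :: "(real ^ 'n \<Rightarrow> real) \<Rightarrow> (real ^ 'n) set \<Rightarrow> real ^ 'n \<Rightarrow> real" where
  "corrected u K x = (\<Sum>\<alpha>\<in>UNIV. slope u K $ \<alpha> * cell K \<alpha> x)"

lemma corrected_H1: "K \<in> T \<Longrightarrow> corrected u K \<in> H1 (interior K)"
  using H1_sum[OF element_geometry(5,6), of K UNIV "cell K" "\<lambda>\<alpha>. slope u K $ \<alpha>"] cell_H1
  by (simp add: corrected_def[abs_def])

text \<open>
  Uniqueness of the local Dirichlet problem. The difference \<open>d\<close> of \<open>u\<epsilon>\<close> and the reconstruction has zero boundary values
  and is a test function for the equations of both; its energy is therefore zero.
\<close>

lemma ms_pair_local:
  assumes p: "ms_pair u u\<epsilon>" and K: "K \<in> T"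
  shows "AE x in lebesgue_on (interior K). u\<epsilon> x = u x + (\<Sum>\<alpha>\<in>UNIV. slope u K $ \<alpha> * w K \<alpha> x)"
    and "\<exists>g. is_weak_grad (interior K) (\<lambda>x. u\<epsilon> x - corrected u K x) g \<and> (AE x in lebesgue_on (interior K). g x = 0)"
proof -
  let ?S = "interior K"
  note E = element_geometry(5,6)[OF K] Linfty_element[OF K A_Linfty]
  obtain c where c: "\<And>x. x \<in> K \<Longrightarrow> u x = slope u K \<bullet> x + c" using VH_affine[OF ms_pairD(1)[OF p] K] by blast
  let ?W = "\<lambda>x. \<Sum>\<alpha>\<in>UNIV. slope u K $ \<alpha> * w K \<alpha> x"
  define d where "d x = 1 * (u\<epsilon> x - u x) + (-1) * ?W x" for x
  have WH: "?W \<in> H10 ?S" using corrD(1)[OF K] by (intro H10_sum E) auto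
  have d: "d \<in> H10 ?S"
    unfolding d_def using H10_lincomb[OF E(1,2) ms_pairD(6)[OF p K] WH] by fast
  define e where "e x = 1 * u\<epsilon> x + (-1) * corrected u K x" for x
  have u\<epsilon>H: "u\<epsilon> \<in> H1 ?S" using ms_pairD(4)[OF p] by (intro H1_element K)
  have eH: "e \<in> H1 ?S"
    unfolding e_def using H1_lincomb[OF E(1,2) u\<epsilon>H corrected_H1[OF K]] by fast
  \<comment> \<open>The two candidates for the difference differ by the constant term of the affine function.\<close>
  have de: "d x = e x - c" if "x \<in> ?S" for x
  proof -
    have "x \<in> K" using that interior_subset by blast
    from c[OF this] show ?thesis
      by (simp add: d_def e_def corrected_def cell_def distrib_left sum.distrib inner_vec_def)
  qed
  have "is_weak_grad ?S (\<lambda>x. 1 * d x + 1 * c) (\<lambda>x. 1 *\<^sub>R wgrad ?S d x + 1 *\<^sub>R grad (\<lambda>x. c) x)"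
    using grad_L2(1)[OF E(1,2) Ck_const]
    by (intro is_weak_grad_lincomb E H10D[OF d] is_weak_grad_C1[OF E(1,2) Ck_const])
  then have "is_weak_grad ?S (\<lambda>x. 1 * d x + 1 * c) (wgrad ?S d)"
    by (simp add: grad_def pd_const zero_vec_def[symmetric])
  then have eW: "is_weak_grad ?S e (wgrad ?S d)"
    by (rule is_weak_grad_cong) (simp add: de)
  \<comment> \<open>Since e and d have the same gradient, this is the energy of d.\<close>
  have "bform ?S A e d = 1 * bform ?S A u\<epsilon> d + (-1) * bform ?S A (corrected u K) d"
    unfolding e_def by (rule bform_lincomb_left[OF E u\<epsilon>H corrected_H1[OF K] H10_H1[OF d]])
  also have "bform ?S A u\<epsilon> d = 0" by (rule ms_pairD(5)[OF p K d])
  also have "bform ?S A (corrected u K) d = 0"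
    using bform_sum_left[OF E, where I=UNIV and u="cell K" and c="\<lambda>\<alpha>. slope u K $ \<alpha>" and z=d]
      cell_H1[OF K] H10_H1[OF d] bform_cell_H10[OF K d]
    by (simp add: corrected_def[abs_def])
  finally have "(LINT x|lebesgue_on ?S. wgrad ?S d x \<bullet> (A x *v wgrad ?S d x)) = 0"
    by (simp add: bform_eq[OF E eW H10D(2)[OF d]])
  then have g0: "AE x in lebesgue_on ?S. wgrad ?S d x = 0"
    using H10D(2)[OF d] coercive_AE[OF element_geometry(7,4)[OF K] coercive] m_pos E(3)
    by (intro grad_AE_zero_if_energy_zero[of ?S m A] element_geometry(7)[OF K]) (auto simp: is_weak_grad_def)
  have "is_weak_grad ?S (\<lambda>x. u\<epsilon> x - corrected u K x) (wgrad ?S d)"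
    using eW by (simp add: e_def[abs_def])
  with g0 show "\<exists>g. is_weak_grad ?S (\<lambda>x. u\<epsilon> x - corrected u K x) g \<and> (AE x in lebesgue_on ?S. g x = 0)"
    by (intro exI[of _ "wgrad ?S d"] conjI)
  have "AE x in lebesgue_on ?S. d x = 0"
    by (rule H10_AE_zero_if_grad_zero[OF E(1,2) d H10D(2)[OF d] g0])
  then show "AE x in lebesgue_on ?S. u\<epsilon> x = u x + ?W x"
    by eventually_elim (simp add: d_def)
qed

text \<open>
  On each element, \<open>v\<epsilon> - v\<close> has zero boundary values and \<open>u\<epsilon>\<close> is orthogonal to it in the energy form.
\<close>

lemma bform_ms_pair_petrov:
  assumes u: "ms_pair u u\<epsilon>" and v: "ms_pair v v\<epsilon>"
  shows "bform \<Omega> A u\<epsilon> v\<epsilon> = bform \<Omega> A u\<epsilon> v"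
proof -
  have "bform (interior K) A u\<epsilon> v\<epsilon> = bform (interior K) A u\<epsilon> v" if K: "K \<in> T" for K
  proof -
    note E = element_geometry(5,6)[OF K] Linfty_element[OF K A_Linfty]
    have "bform (interior K) A u\<epsilon> (\<lambda>x. 1 * v\<epsilon> x + (-1) * v x) = 1 * bform (interior K) A u\<epsilon> v\<epsilon> + (-1) * bform (interior K) A u\<epsilon> v"
      using ms_pairD[OF u] ms_pairD[OF v] K by (intro bform_lincomb_right E H1_element) auto
    with ms_pairD(5)[OF u K ms_pairD(6)[OF v K]] show ?thesis by simp
  qed
  with ms_pairD(2,4)[OF u] ms_pairD(2,4)[OF v] A_Linfty show ?thesis by (simp add: bform_mesh)
qed

text \<open>
  On each element both arguments may be replaced by their reconstructions, which have the same gradients. Expanding these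
  in the functions \<open>cell K \<alpha>\<close> leaves exactly the entries of the effective matrix.
\<close>

lemma bform_ms_pair_effective:
  assumes u: "ms_pair u u\<epsilon>" and v: "ms_pair v v\<epsilon>"
  shows "bform \<Omega> A u\<epsilon> v\<epsilon> = bform \<Omega> (eff_field T A w) u v"
proof -
  have "bform (interior K) A u\<epsilon> v\<epsilon> = bform (interior K) (eff_field T A w) u v" if K: "K \<in> T" for K
  proof -
    let ?S = "interior K"
    note E = element_geometry(5,6)[OF K] Linfty_element[OF K A_Linfty]
    have H: "u\<epsilon> \<in> H1 ?S" "v\<epsilon> \<in> H1 ?S" using ms_pairD(4) u v K by (auto intro: H1_element)
    note C = corrected_H1[OF K]
    obtain p where p: "is_weak_grad ?S (\<lambda>x. u\<epsilon> x - corrected u K x) p" "AE x in lebesgue_on ?S. p x = 0"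
      using ms_pair_local(2)[OF u K] by blast
    obtain q where q: "is_weak_grad ?S (\<lambda>x. v\<epsilon> x - corrected v K x) q" "AE x in lebesgue_on ?S. q x = 0"
      using ms_pair_local(2)[OF v K] by blast
    have "bform ?S A (\<lambda>x. 1 * u\<epsilon> x + (-1) * corrected u K x) v\<epsilon> = 1 * bform ?S A u\<epsilon> v\<epsilon> + (-1) * bform ?S A (corrected u K) v\<epsilon>"
      by (rule bform_lincomb_left[OF E H(1) C H(2)])
    moreover have "bform ?S A (\<lambda>x. 1 * u\<epsilon> x + (-1) * corrected u K x) v\<epsilon> = 0"
      using p by (simp add: bform_eq_0_if_grad_zero[OF E p(1) wgrad_is_weak_grad[OF H(2)]])
    moreover have "bform ?S A (corrected u K) (\<lambda>x. 1 * v\<epsilon> x + (-1) * corrected v K x)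
        = 1 * bform ?S A (corrected u K) v\<epsilon> + (-1) * bform ?S A (corrected u K) (corrected v K)"
      by (rule bform_lincomb_right[OF E H(2) C C])
    moreover have "bform ?S A (corrected u K) (\<lambda>x. 1 * v\<epsilon> x + (-1) * corrected v K x) = 0"
      using q by (simp add: bform_eq_0_if_grad_zero[OF E wgrad_is_weak_grad[OF C] q(1)])
    ultimately have "bform ?S A u\<epsilon> v\<epsilon> = bform ?S A (corrected u K) (corrected v K)" by simp
    also have "\<dots> = (\<Sum>\<alpha>\<in>UNIV. slope u K $ \<alpha> * bform ?S A (cell K \<alpha>) (corrected v K))"
      unfolding corrected_def[of u, abs_def] using cell_H1[OF K] C by (intro bform_sum_left E) auto
    also have "\<dots> = (\<Sum>\<alpha>\<in>UNIV. slope u K $ \<alpha> * (\<Sum>\<beta>\<in>UNIV. slope v K $ \<beta> * bform ?S A (cell K \<alpha>) (cell K \<beta>)))"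
      unfolding corrected_def[of v, abs_def] using cell_H1[OF K]
      by (intro sum.cong refl arg_cong2[where f="(*)"] bform_sum_right E) auto
    also have "\<dots> = (\<Sum>\<alpha>\<in>UNIV. \<Sum>\<beta>\<in>UNIV. measure lebesgue K * (slope v K $ \<beta> * (eff_matrix A w K $ \<beta> $ \<alpha> * slope u K $ \<alpha>)))"
      using element_geometry(8,9)[OF K] by (simp add: eff_matrix_def cell_def[abs_def] sum_distrib_left mult_ac)
    also have "\<dots> = measure lebesgue K * (slope v K \<bullet> (eff_matrix A w K *v slope u K))"
      by (subst sum.swap) (simp add: inner_vec_def matrix_vector_mult_def sum_distrib_left)
    also have "\<dots> = (LINT x|lebesgue_on ?S. slope v K \<bullet> (eff_field T A w x *v slope u K))"
    proof -
      have "(LINT x|lebesgue_on ?S. slope v K \<bullet> (eff_field T A w x *v slope u K))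
         = (LINT x|lebesgue_on ?S. slope v K \<bullet> (eff_matrix A w K *v slope u K))"
        by (rule Bochner_Integration.integral_cong) (auto simp: eff_field_element[OF K])
      then show ?thesis
        using element_geometry(7,9)[OF K] by (simp add: measure_restrict_space)
    qed
    also have "\<dots> = bform ?S (eff_field T A w) u v"
      using ms_pairD(1) u v K
      by (intro bform_eq[symmetric] E(1,2) Linfty_element eff_field_Linfty VH_weak_grad) auto
    finally show ?thesis .
  qed
  with ms_pairD(2,4)[OF u] ms_pairD(2,4)[OF v] A_Linfty eff_field_Linfty show ?thesis by (simp add: bform_mesh)
qed

text \<open>
  A vanishing gradient of \<open>u\<epsilon>\<close> makes the gradient of \<open>u\<epsilon> - u\<close> on \<open>K\<close> the constant \<open>- slope u K\<close>, which has to have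
  mean zero.
\<close>

lemma ms_pair_zero_if_energy_zero:
  assumes p: "ms_pair u u\<epsilon>" and 0: "bform \<Omega> A u\<epsilon> u\<epsilon> \<le> 0"
  shows "u x = 0"
proof (rule VH_eq_0_if_slopes_zero[OF ms_pairD(1)[OF p]])
  let ?g = "wgrad \<Omega> u\<epsilon>"
  note W = wgrad_is_weak_grad[OF ms_pairD(4)[OF p]]
  have g0: "AE x in lebesgue_on \<Omega>. ?g x = 0"
    using 0 W coercive_AE[OF \<Omega>_lebesgue subset_refl coercive] m_pos A_Linfty
    by (intro grad_AE_zero_if_energy_zero[of \<Omega> m A] \<Omega>_lebesgue)
       (auto simp: is_weak_grad_def bform_eq[OF open_\<Omega> bounded_\<Omega> A_Linfty W W])
  fix K assume K: "K \<in> T"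
  let ?S = "interior K"
  note E = element_geometry(5,6)[OF K]
  have g: "is_weak_grad ?S u\<epsilon> ?g"
    by (rule is_weak_grad_mono[OF E(1) open_\<Omega> element_geometry(4)[OF K] W])
  have L: "u\<epsilon> \<in> L2 ?S" "u \<in> L2 ?S"
    using ms_pairD(2,4)[OF p] K by (auto intro: H1_L2 H1_element)
  have "is_weak_grad ?S (\<lambda>x. 1 * u\<epsilon> x + (-1) * u x) (\<lambda>x. 1 *\<^sub>R ?g x + (-1) *\<^sub>R slope u K)"
    by (rule is_weak_grad_lincomb[OF E(1) L(1) g L(2) VH_weak_grad[OF ms_pairD(1)[OF p] K]])
  then have d: "is_weak_grad ?S (\<lambda>x. u\<epsilon> x - u x) (\<lambda>x. ?g x - slope u K)" by simp
  have "slope u K $ i = 0" for i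
  proof -
    have "0 = (LINT x|lebesgue_on ?S. (?g x - slope u K) $ i)"
      by (rule H10_mean_grad_zero[OF E ms_pairD(6)[OF p K] d, symmetric])
    also have "\<dots> = (LINT x|lebesgue_on ?S. - slope u K $ i)"
    proof (rule integral_cong_AE)
      show "AE x in lebesgue_on ?S. (?g x - slope u K) $ i = - slope u K $ i"
        using AE_restrict_element[OF K g0] by eventually_elim simp
      have "(\<lambda>x. ?g x - slope u K) \<in> L2 ?S" using d by (simp add: is_weak_grad_def)
      from L2_nth[OF element_geometry(7)[OF K] this, of i]
      show "(\<lambda>x. (?g x - slope u K) $ i) \<in> borel_measurable (lebesgue_on ?S)"
        by (simp add: L2_iff[OF element_geometry(7)[OF K]])
    qed simp
    also have "\<dots> = - measure lebesgue ?S * slope u K $ i"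
      using element_geometry(7)[OF K] by (simp add: measure_restrict_space)
    finally show ?thesis using element_geometry(8)[OF K] by simp
  qed
  then show "slope u K = 0" by (simp add: vec_eq_iff)
qed

end

section \<open>The discrete problems\<close>

text \<open>
  Testing with the spanning functions is enough, and turns the variational problem into a linear system for the
  coefficients.
\<close>

lemma solves_span_iff:
  assumes bil: "\<And>c b. a (\<lambda>x. \<Sum>i\<in>{1..N}. c i * \<phi> i x) (\<lambda>x. \<Sum>j\<in>{1..N}. b j * \<psi> j x)
      = (\<Sum>j\<in>{1..N}. b j * (\<Sum>i\<in>{1..N}. a (\<phi> i) (\<psi> j) * c i))"
    and lin: "\<And>b. F (\<lambda>x. \<Sum>j\<in>{1..N}. b j * \<psi> j x) = (\<Sum>j\<in>{1..N}. b j * F (\<psi> j))"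
  shows "solves a F (span_fun N \<phi>) (span_fun N \<psi>) u \<longleftrightarrow>
    (\<exists>c. u = (\<lambda>x. \<Sum>i\<in>{1..N}. c i * \<phi> i x) \<and>
         (\<forall>j\<in>{1..N}. (\<Sum>i\<in>{1..N}. a (\<phi> i) (\<psi> j) * c i) = F (\<psi> j)))"
proof -
  have *: "(\<forall>v\<in>span_fun N \<psi>. a (\<lambda>x. \<Sum>i\<in>{1..N}. c i * \<phi> i x) v = F v) \<longleftrightarrow>
     (\<forall>j\<in>{1..N}. (\<Sum>i\<in>{1..N}. a (\<phi> i) (\<psi> j) * c i) = F (\<psi> j))" (is "?L \<longleftrightarrow> ?R") for c
  proof
    assume L: ?L
    show ?R
    proof
      fix j assume j: "j \<in> {1..N}"
      let ?b = "\<lambda>k. if k = j then 1 else 0 :: real"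
      have "(\<Sum>k\<in>{1..N}. ?b k * z k) = z j" for z
      proof -
        have "(\<Sum>k\<in>{1..N}. ?b k * z k) = (\<Sum>k\<in>{1..N}. if k = j then z k else 0)"
          by (intro sum.cong) auto
        with j show ?thesis by simp
      qed
      moreover have "a (\<lambda>x. \<Sum>i\<in>{1..N}. c i * \<phi> i x) (\<lambda>x. \<Sum>k\<in>{1..N}. ?b k * \<psi> k x) = F (\<lambda>x. \<Sum>k\<in>{1..N}. ?b k * \<psi> k x)"
        using L by (auto simp: span_fun_def)
      ultimately show "(\<Sum>i\<in>{1..N}. a (\<phi> i) (\<psi> j) * c i) = F (\<psi> j)"
        unfolding bil lin by simp
    qed
  next
    assume R: ?R
    show ?L
    proof
      fix v assume "v \<in> span_fun N \<psi>"
      then obtain b where v: "v = (\<lambda>x. \<Sum>j\<in>{1..N}. b j * \<psi> j x)" by (auto simp: span_fun_def)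
      show "a (\<lambda>x. \<Sum>i\<in>{1..N}. c i * \<phi> i x) v = F v"
        unfolding v bil lin using R by simp
    qed
  qed
  show ?thesis
    unfolding solves_def using * by (auto simp: span_fun_def)
qed

lemma lform_sum:
  assumes S: "S \<in> sets lebesgue" and i: "\<And>j. j \<in> J \<Longrightarrow> set_integrable lebesgue S (\<lambda>x. f x * \<psi> j x)"
  shows "lform S f (\<lambda>x. \<Sum>j\<in>J. b j * \<psi> j x) = (\<Sum>j\<in>J. b j * lform S f (\<psi> j))"
proof -
  have "lform S f (\<lambda>x. \<Sum>j\<in>J. b j * \<psi> j x)
     = (LINT x|lebesgue. (\<Sum>j\<in>J. b j * (indicator S x *\<^sub>R (f x * \<psi> j x))))"
    unfolding lform_def set_lebesgue_integral_def
    by (intro Bochner_Integration.integral_cong refl) (simp add: sum_distrib_left mult_ac)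
  also have "\<dots> = (\<Sum>j\<in>J. b j * lform S f (\<psi> j))"
    using i unfolding set_integrable_def
    by (subst Bochner_Integration.integral_sum) (auto simp: lform_def set_lebesgue_integral_def)
  finally show ?thesis .
qed

theorem lemma4:
  fixes \<Omega> :: "(real ^ 'n::finite) set"
    and A :: "real ^ 'n \<Rightarrow> real ^ 'n ^ 'n"
    and m M :: real
    and f :: "real ^ 'n \<Rightarrow> real"
    and T :: "(real ^ 'n) set set"
    and N :: nat
    and xs :: "nat \<Rightarrow> real ^ 'n"
    and \<phi> \<phi>\<epsilon> :: "nat \<Rightarrow> real ^ 'n \<Rightarrow> real"
    and w :: "(real ^ 'n) set \<Rightarrow> 'n \<Rightarrow> real ^ 'n \<Rightarrow> real"
  assumes domain: "open \<Omega>" "connected \<Omega>" "\<Omega> \<noteq> {}" "bounded \<Omega>"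
    and A_Linfty: "A \<in> Linfty \<Omega>"
    and constants: "0 < m" "m \<le> M"
    and coercive: "\<forall>\<xi>. AE x in lebesgue. x \<in> \<Omega> \<longrightarrow> m * (norm \<xi>)\<^sup>2 \<le> \<xi> \<bullet> (A x *v \<xi>)"
    and bounded: "\<forall>\<xi> \<eta>. AE x in lebesgue. x \<in> \<Omega> \<longrightarrow> \<bar>\<eta> \<bullet> (A x *v \<xi>)\<bar> \<le> M * norm \<xi> * norm \<eta>"
    and load: "bounded_lform_on_H10 \<Omega> f"
    and mesh: "simplicial_mesh \<Omega> T"
    and vertices: "bij_betw xs {1..N} (interior_vertices \<Omega> T)"
    and P1: "P1_basis \<Omega> T N xs \<phi>"
    and ms: "\<forall>i\<in>{1..N}. ms_basis_function \<Omega> T A (\<phi> i) (\<phi>\<epsilon> i)"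
    and corr: "\<forall>K\<in>T. \<forall>\<alpha>. corrector K A \<alpha> (w K \<alpha>)"
  shows "let a = bform \<Omega> A;
             abar = bform \<Omega> (eff_field T A w);
             F = lform \<Omega> f;
             V = VH \<Omega> T;
             V\<epsilon> = span_fun N \<phi>\<epsilon>;
             G_sys = system_of a F \<phi>\<epsilon> \<phi>\<epsilon>;
             PG_sys = system_of a F \<phi>\<epsilon> \<phi>;
             P1_sys = system_of abar F \<phi> \<phi>
         in (\<forall>i\<in>{1..N}. \<forall>j\<in>{1..N}.
               stiffness G_sys j i = stiffness PG_sys j i \<and>
               stiffness PG_sys j i = stiffness P1_sys j i) \<and>
            (\<forall>j\<in>{1..N}. rhs PG_sys j = rhs P1_sys j) \<and>
            (\<exists>!u. solves a F V\<epsilon> V u) \<and> (\<exists>!u. solves abar F V V u) \<and>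
            (\<forall>uPG uH. solves a F V\<epsilon> V uPG \<and> solves abar F V V uH \<longrightarrow>
               (\<forall>K\<in>T. AE x in lebesgue. x \<in> interior K \<longrightarrow>
                  uPG x = uH x + (\<Sum>\<alpha>\<in>UNIV. pd \<alpha> uH x * w K \<alpha> x)))"
proof -
  interpret msfem \<Omega> A m T w
    by unfold_locales (use domain A_Linfty constants coercive mesh corr in auto)
  let ?I = "{1..N}"
  let ?u = "\<lambda>c x. \<Sum>i\<in>?I. c i * \<phi> i x"
  let ?u\<epsilon> = "\<lambda>c x. \<Sum>i\<in>?I. c i * \<phi>\<epsilon> i x"
  let ?a = "bform \<Omega> A" and ?abar = "bform \<Omega> (eff_field T A w)" and ?F = "lform \<Omega> f"
  define S where "S j i = ?a (\<phi>\<epsilon> i) (\<phi> j)" for j i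
  have nodal: "\<phi> i (xs j) = (if i = j then 1 else 0)" if "i \<in> ?I" "j \<in> ?I" for i j
    using P1 that by (simp add: P1_basis_def)
  have pair: "ms_pair (\<phi> i) (\<phi>\<epsilon> i)" if "i \<in> ?I" for i
    using P1 ms that by (simp add: P1_basis_def ms_pair_def)
  note V = ms_pairD(1)[OF pair] and H = ms_pairD(2)[OF pair] and H\<epsilon> = ms_pairD(4)[OF pair]
  have pairs: "ms_pair (?u c) (?u\<epsilon> c)" for c
    by (intro ms_pair_sum pair) auto
  have eval: "?u c (xs j) = c j" if j: "j \<in> ?I" for c j
  proof -
    have "?u c (xs j) = (\<Sum>i\<in>?I. if i = j then c i else 0)"
      using nodal j by (intro sum.cong) auto
    with j show ?thesis by simp
  qed
  have VH_span: "VH \<Omega> T = span_fun N \<phi>"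
  proof (intro equalityI subsetI)
    fix v assume v: "v \<in> VH \<Omega> T"
    let ?c = "\<lambda>i. v (xs i)"
    \<comment> \<open>A function in \<open>VH\<close> is recovered from its values at the interior vertices.\<close>
    have z: "(\<lambda>x. 1 * v x + (-1) * ?u ?c x) \<in> VH \<Omega> T"
      by (intro VH_lincomb v ms_pairD(1)[OF pairs])
    have diff: "1 * v x + (-1) * ?u ?c x = 0" for x
    proof (rule VH_eq_0_if_vertices_zero[OF z])
      fix y assume "y \<in> interior_vertices \<Omega> T"
      then obtain j where "j \<in> ?I" "y = xs j" using vertices unfolding bij_betw_def by blast
      then show "1 * v y + (-1) * ?u ?c y = 0" using eval[of j ?c] by simp
    qed
    have "v = ?u ?c"
    proof
      fix x
      from diff[of x] show "v x = ?u ?c x" by linarith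
    qed
    then show "v \<in> span_fun N \<phi>"
      unfolding span_fun_def mem_Collect_eq by (rule exI[of _ ?c])
  next
    fix v assume "v \<in> span_fun N \<phi>"
    then show "v \<in> VH \<Omega> T" using ms_pairD(1)[OF pairs] by (auto simp: span_fun_def)
  qed
  have galerkin: "?a (\<phi>\<epsilon> i) (\<phi>\<epsilon> j) = S j i" and effective: "?abar (\<phi> i) (\<phi> j) = S j i"
    if "i \<in> ?I" "j \<in> ?I" for i j
    unfolding S_def using bform_ms_pair_petrov[OF pair pair] bform_ms_pair_effective[OF pair pair] that by metis+
  have bil: "?a (?u\<epsilon> c) (?u b) = (\<Sum>j\<in>?I. b j * (\<Sum>i\<in>?I. ?a (\<phi>\<epsilon> i) (\<phi> j) * c i))" for c b
  proof -
    have "?a (?u\<epsilon> c) (?u b) = (\<Sum>j\<in>?I. b j * ?a (?u\<epsilon> c) (\<phi> j))"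
      by (intro bform_sum_right open_\<Omega> bounded_\<Omega> A_Linfty H ms_pairD(4)[OF pairs]) auto
    also have "\<dots> = (\<Sum>j\<in>?I. b j * (\<Sum>i\<in>?I. c i * ?a (\<phi>\<epsilon> i) (\<phi> j)))"
      by (intro sum.cong refl arg_cong2[where f="(*)"] bform_sum_left open_\<Omega> bounded_\<Omega> A_Linfty H H\<epsilon>) auto
    finally show ?thesis by (simp add: mult.commute)
  qed
  have bil_bar: "?abar (?u c) (?u b) = (\<Sum>j\<in>?I. b j * (\<Sum>i\<in>?I. ?abar (\<phi> i) (\<phi> j) * c i))" for c b
  proof -
    have "?abar (?u c) (?u b) = (\<Sum>j\<in>?I. b j * ?abar (?u c) (\<phi> j))"
      by (intro bform_sum_right open_\<Omega> bounded_\<Omega> eff_field_Linfty H ms_pairD(2)[OF pairs]) auto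
    also have "\<dots> = (\<Sum>j\<in>?I. b j * (\<Sum>i\<in>?I. c i * ?abar (\<phi> i) (\<phi> j)))"
      by (intro sum.cong refl arg_cong2[where f="(*)"] bform_sum_left open_\<Omega> bounded_\<Omega> eff_field_Linfty H) auto
    finally show ?thesis by (simp add: mult.commute)
  qed
  have lin: "?F (?u b) = (\<Sum>j\<in>?I. b j * ?F (\<phi> j))" for b
    using load VH_H10[OF V] by (intro lform_sum \<Omega>_lebesgue) (auto simp: bounded_lform_on_H10_def)
  have pos: "0 < (\<Sum>j\<in>?I. c j * (\<Sum>i\<in>?I. S j i * c i))" if c: "\<exists>i\<in>?I. c i \<noteq> 0" for c
  proof (rule ccontr)
    assume "\<not> ?thesis"
    then have "?a (?u\<epsilon> c) (?u c) \<le> 0" unfolding bil S_def not_less .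
    then have "?a (?u\<epsilon> c) (?u\<epsilon> c) \<le> 0" by (simp only: bform_ms_pair_petrov[OF pairs pairs])
    from ms_pair_zero_if_energy_zero[OF pairs this] have "?u c (xs j) = 0" for j .
    with eval c show False by metis
  qed
  define sol where "sol c \<longleftrightarrow> (\<forall>j\<in>?I. (\<Sum>i\<in>?I. S j i * c i) = ?F (\<phi> j))" for c
  have "\<exists>c. \<forall>j\<in>?I. (\<Sum>i\<in>?I. S j i * c i) = ?F (\<phi> j)"
    by (rule positive_definite_solvable) (use pos in auto)
  then obtain c where c: "sol c" unfolding sol_def by blast
  have unique: "c1 i = c2 i" if "sol c1" "sol c2" "i \<in> ?I" for c1 c2 i
  proof (rule ccontr)
    assume "c1 i \<noteq> c2 i"
    with that(3) have "0 < (\<Sum>j\<in>?I. (c1 j - c2 j) * (\<Sum>i\<in>?I. S j i * (c1 i - c2 i)))"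
      by (intro pos) auto
    also have "\<dots> = 0"
      using that(1,2) by (intro sum.neutral) (simp add: sol_def right_diff_distrib sum_subtractf)
    finally show False by simp
  qed
  have PG: "solves ?a ?F (span_fun N \<phi>\<epsilon>) (VH \<Omega> T) u \<longleftrightarrow> (\<exists>c. u = ?u\<epsilon> c \<and> sol c)" for u
    unfolding VH_span sol_def S_def by (rule solves_span_iff[OF bil lin])
  have sol_bar: "(\<forall>j\<in>?I. (\<Sum>i\<in>?I. ?abar (\<phi> i) (\<phi> j) * c i) = ?F (\<phi> j)) \<longleftrightarrow> sol c" for c
  proof -
    have "(\<Sum>i\<in>?I. ?abar (\<phi> i) (\<phi> j) * c i) = (\<Sum>i\<in>?I. S j i * c i)" if "j \<in> ?I" for j
      using effective that by (intro sum.cong) auto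
    then show ?thesis unfolding sol_def by (intro ball_cong refl) (simp only:)
  qed
  have P1: "solves ?abar ?F (VH \<Omega> T) (VH \<Omega> T) u \<longleftrightarrow> (\<exists>c. u = ?u c \<and> sol c)" for u
    unfolding VH_span solves_span_iff[OF bil_bar lin] sol_bar ..
  have cong\<epsilon>: "?u\<epsilon> c1 = ?u\<epsilon> c2" and cong: "?u c1 = ?u c2" if "sol c1" "sol c2" for c1 c2
    using unique[OF that] by auto
  have ex1: "\<exists>!u. solves ?a ?F (span_fun N \<phi>\<epsilon>) (VH \<Omega> T) u"
    unfolding PG using c cong\<epsilon> by blast
  have ex2: "\<exists>!u. solves ?abar ?F (VH \<Omega> T) (VH \<Omega> T) u"
    unfolding P1 using c cong by blast
  have rep: "AE x in lebesgue. x \<in> interior K \<longrightarrow> uPG x = uH x + (\<Sum>\<alpha>\<in>UNIV. pd \<alpha> uH x * w K \<alpha> x)"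
    if sols: "solves ?a ?F (span_fun N \<phi>\<epsilon>) (VH \<Omega> T) uPG" "solves ?abar ?F (VH \<Omega> T) (VH \<Omega> T) uH" and K: "K \<in> T" for uPG uH K
  proof -
    from sols(1) obtain c1 where c1: "uPG = ?u\<epsilon> c1" "sol c1" unfolding PG by (elim exE conjE)
    from sols(2) obtain c2 where c2: "uH = ?u c2" "sol c2" unfolding P1 by (elim exE conjE)
    have p: "ms_pair uH uPG"
      unfolding c1(1) c2(1) cong\<epsilon>[OF c1(2) c2(2)] by (rule pairs)
    have "AE x in lebesgue. x \<in> interior K \<longrightarrow> uPG x = uH x + (\<Sum>\<alpha>\<in>UNIV. slope uH K $ \<alpha> * w K \<alpha> x)"
      using ms_pair_local(1)[OF p K] element_geometry(7)[OF K] by (simp add: AE_restrict_space_iff)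
    then show ?thesis
      by eventually_elim (simp add: VH_pd[OF ms_pairD(1)[OF p] K])
  qed
  show ?thesis
    unfolding Let_def
  proof (intro conjI ballI)
    fix i j assume "i \<in> ?I" "j \<in> ?I"
    with galerkin effective
    show "stiffness (system_of ?a ?F \<phi>\<epsilon> \<phi>\<epsilon>) j i = stiffness (system_of ?a ?F \<phi>\<epsilon> \<phi>) j i"
      "stiffness (system_of ?a ?F \<phi>\<epsilon> \<phi>) j i = stiffness (system_of ?abar ?F \<phi> \<phi>) j i"
      by (simp_all add: system_of_def S_def)
  qed (use ex1 ex2 rep in \<open>auto simp: system_of_def\<close>)
qed

end
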